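(* Let $a\in(0,1)$, let $\phi_a(z)=az+1-a$, and let $\Theta$ be an inner function. Then the model space $(\Theta H^2)^{\perp}$ is invariant under the composition operator $C_{\phi_a}$ on $H^2$ if and only if $(\Theta H^2)^{\perp}=(e_nH^2)^{\perp}$ for some integer $n\geq 0$, where $e_n(z)=z^n$ (equivalently, $\Theta=\lambda z^n$ for some unimodular constant $\lambda$ and some integer $n\ge 0$).
   Context: $H^2$ is the Hardy–Hilbert space of the open unit disk $\mathbb{D}$. For $a\in(0,1)$, $\phi_a(z)=az+1-a$ is a holomorphic self-map of $\mathbb{D}$ and $C_{\phi_a}f=f\circ\phi_a$ is the associated bounded composition operator on $H^2$. An inner function is a function $\Theta\in H^2$ whose radial limits have modulus $1$ almost everywhere on the unit circle (unimodular constants are inner). A model space is a subspace $(\Theta H^2)^{\perp}$ (orthogonal complement in $H^2$) with $\Theta$ inner. A closed subspace $M$ is invariant under $C_{\phi_a}$ if $C_{\phi_a}M\subseteq M$. *)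

theory Defs
  imports "HOL-Complex_Analysis.Complex_Analysis"
begin

(* Functions on the unit disk are modelled as functions on the whole complex plane whose values
   outside ball 0 1 are irrelevant. Membership in hardy2, the Taylor coefficients at 0 and the radial
   limits depend only on the restriction to the disk, and so does composition with a self-map of the
   disk. In particular two sets hardy2_orth M and hardy2_orth N are equal if and only if they contain
   the same functions on the disk. *)

definition taylor_coeff :: "(complex \<Rightarrow> complex) \<Rightarrow> nat \<Rightarrow> complex" where
  "taylor_coeff f n = fps_nth (fps_expansion f 0) n"

definition hardy2 :: "(complex \<Rightarrow> complex) set" where
  "hardy2 = {f. f holomorphic_on ball 0 1 \<and> summable (\<lambda>n. (cmod (taylor_coeff f n))\<^sup>2)}"

definition hardy2_inner :: "(complex \<Rightarrow> complex) \<Rightarrow> (complex \<Rightarrow> complex) \<Rightarrow> complex" where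
  "hardy2_inner f g = (\<Sum>n. taylor_coeff f n * cnj (taylor_coeff g n))"

definition hardy2_orth :: "(complex \<Rightarrow> complex) set \<Rightarrow> (complex \<Rightarrow> complex) set" where
  "hardy2_orth M = {f \<in> hardy2. \<forall>g\<in>M. hardy2_inner f g = 0}"

definition inner_function :: "(complex \<Rightarrow> complex) \<Rightarrow> bool" where
  "inner_function \<Theta> \<longleftrightarrow> \<Theta> \<in> hardy2 \<and>
     (AE t in lebesgue_on {0..2 * pi}.
        \<exists>l. ((\<lambda>r. \<Theta> (of_real r * cis t)) \<longlongrightarrow> l) (at_left 1) \<and> cmod l = 1)"

(* An inner function is bounded, hence the products below belong to hardy2. *)
definition model_space :: "(complex \<Rightarrow> complex) \<Rightarrow> (complex \<Rightarrow> complex) set" where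
  "model_space \<Theta> = hardy2_orth {\<lambda>z. \<Theta> z * h z | h. h \<in> hardy2}"

definition comp_op ::
    "(complex \<Rightarrow> complex) \<Rightarrow> (complex \<Rightarrow> complex) \<Rightarrow> (complex \<Rightarrow> complex)" where
  "comp_op \<phi> f = f \<circ> \<phi>"

definition invariant_under ::
    "((complex \<Rightarrow> complex) \<Rightarrow> (complex \<Rightarrow> complex)) \<Rightarrow> (complex \<Rightarrow> complex) set \<Rightarrow> bool" where
  "invariant_under T M \<longleftrightarrow> T ` M \<subseteq> M"

definition affine_symbol :: "real \<Rightarrow> complex \<Rightarrow> complex" where
  "affine_symbol a z = of_real a * z + 1 - of_real a"

end

theory Submission
  imports Defs "HOL-Real_Asymp.Real_Asymp"
begin

text \<open>Let \<open>K w\<close> be the reproducing kernel of the Hardy space. The model space of \<open>\<Theta>\<close> contains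
  \<open>K w - cnj (\<Theta> w) \<Theta> (K w)\<close>. Composing this with \<open>\<phi> z = a z + 1 - a\<close> turns \<open>K w\<close> into a multiple of
  \<open>K (\<sigma> w)\<close>, where \<open>\<sigma> w = a w / (1 - (1 - a) w)\<close>, so orthogonality to \<open>\<Theta> (K (\<sigma> w))\<close> gives
  \<open>|\<Theta> (\<sigma> w)| \<le> |\<Theta> w|\<close>. The same holds with \<open>a ^ k\<close> in place of \<open>a\<close>, and then \<open>\<sigma> w\<close> tends to \<open>0\<close>.
  Write \<open>\<Theta> z = z ^ n G z\<close> with \<open>G 0 \<noteq> 0\<close>. The inequality excludes zeros of \<open>G\<close> and bounds
  \<open>(G \<circ> \<sigma>) / G\<close>; as \<open>G\<close> is inner this quotient is bounded by one, hence \<open>|G 0| \<le> |G w|\<close> in the limit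
  and \<open>G\<close> is constant by the maximum principle for \<open>1 / G\<close>.\<close>

section \<open>The Hilbert space of square summable Taylor coefficients\<close>

text \<open>The zero of \<open>\<Theta>\<close> at the origin shapes the second half. Dividing the
  pointwise inequality by the powers of \<open>z\<close> leaves
  \<open>|G (\<sigma> z)| \<le> |z / \<sigma> z| ^ n * |G z|\<close>, with \<open>\<sigma>\<close>
  belonging to \<open>a ^ k\<close>, and this factor grows without bound as \<open>k\<close>
  increases, so the limit cannot be taken yet. For each fixed \<open>k\<close>, however, the factor
  is bounded on the disk, and any bound will do: at the boundary
  \<open>|G \<circ> \<sigma>| \<le> 1 = |G|\<close>, so a maximum principle improves the constant to
  one. Boundary moduli alone would not be enough: for a nonconstant inner \<open>G\<close> without
  zeros, \<open>1 / G\<close> has boundary modulus one and is unbounded. Innerness is used in the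
  form that the functions \<open>z ^ m * \<Theta> z\<close> are orthonormal. This condition on
  Taylor coefficients passes from \<open>\<Theta>\<close> to \<open>G\<close> by a shift and makes
  multiplication by \<open>G\<close> an isometry, so boundary values enter only where the condition
  is derived.\<close>

lemma taylor_coeff_sums:
  assumes "f holomorphic_on ball 0 1" and "z \<in> ball 0 1"
  shows "(\<lambda>n. taylor_coeff f n * z ^ n) sums f z"
  using holomorphic_power_series[OF assms]
  by (simp add: taylor_coeff_def fps_expansion_def)

text \<open>Uniqueness of power series: the computations of \<open>taylor_coeff\<close> below
  exhibit a convergent expansion and read the coefficients off. Convergence at \<open>1/2\<close>
  already gives the positive radius that \<open>has_fps_expansion\<close> asks for.\<close>

lemma power_series_unit_disk:
  assumes "\<And>z. z \<in> ball 0 1 \<Longrightarrow> (\<lambda>n. c n * z ^ n) sums f z"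
  shows "f holomorphic_on ball 0 1" and "taylor_coeff f = c"
proof -
  show "f holomorphic_on ball 0 1"
    using power_series_holomorphic[of 0 1 c f] assms by simp
  have "summable (\<lambda>n. c n * (1/2) ^ n)"
    using assms[of "1/2"] by (simp add: sums_iff)
  then have "ereal (norm (1/2 :: complex)) \<le> conv_radius c"
    by (intro conv_radius_geI) auto
  then have "0 < conv_radius c"
    by (rule less_le_trans[rotated]) simp
  then have "0 < fps_conv_radius (Abs_fps c)"
    by (simp add: fps_conv_radius_def)
  moreover have "\<forall>\<^sub>F z in nhds 0. eval_fps (Abs_fps c) z = f z"
  proof -
    have "\<forall>\<^sub>F z in nhds 0. z \<in> ball (0 :: complex) 1"
      by (intro eventually_nhds_in_open) auto
    then show ?thesis
      by eventually_elim (use assms in \<open>auto simp: eval_fps_def sums_iff\<close>)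
  qed
  ultimately have "f has_fps_expansion Abs_fps c"
    by (simp add: has_fps_expansion_def)
  from fps_expansion_eqI[OF this] show "taylor_coeff f = c"
    by (auto simp: taylor_coeff_def)
qed

lemma taylor_coeff_cong:
  assumes "\<And>z. z \<in> ball 0 1 \<Longrightarrow> f z = g z"
  shows "taylor_coeff f = taylor_coeff g"
proof -
  have "\<forall>\<^sub>F z in nhds 0. z \<in> ball (0 :: complex) 1"
    by (intro eventually_nhds_in_open) auto
  then have "\<forall>\<^sub>F z in nhds 0. f z = g z"
    by eventually_elim (use assms in auto)
  from fps_expansion_cong[OF this] show ?thesis
    by (auto simp: taylor_coeff_def)
qed

lemma taylor_coeff_add:
  assumes "f holomorphic_on ball 0 1" "g holomorphic_on ball 0 1"
  shows "taylor_coeff (\<lambda>z. f z + g z) = (\<lambda>n. taylor_coeff f n + taylor_coeff g n)"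
proof (rule power_series_unit_disk(2))
  fix z :: complex assume "z \<in> ball 0 1"
  with assms show "(\<lambda>n. (taylor_coeff f n + taylor_coeff g n) * z ^ n) sums (f z + g z)"
    by (simp add: distrib_right sums_add taylor_coeff_sums)
qed

lemma taylor_coeff_cmult:
  assumes "f holomorphic_on ball 0 1"
  shows "taylor_coeff (\<lambda>z. c * f z) = (\<lambda>n. c * taylor_coeff f n)"
proof (rule power_series_unit_disk(2))
  fix z :: complex assume "z \<in> ball 0 1"
  with assms show "(\<lambda>n. c * taylor_coeff f n * z ^ n) sums (c * f z)"
    by (simp add: mult.assoc sums_mult taylor_coeff_sums)
qed

lemma taylor_coeff_sum:
  assumes "finite A" "\<And>i. i \<in> A \<Longrightarrow> f i holomorphic_on ball 0 1"
  shows "taylor_coeff (\<lambda>z. \<Sum>i\<in>A. f i z) = (\<lambda>n. \<Sum>i\<in>A. taylor_coeff (f i) n)"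
proof (rule power_series_unit_disk(2))
  fix z :: complex assume "z \<in> ball 0 1"
  with assms show "(\<lambda>n. (\<Sum>i\<in>A. taylor_coeff (f i) n) * z ^ n) sums (\<Sum>i\<in>A. f i z)"
    unfolding sum_distrib_right by (intro sums_sum taylor_coeff_sums) auto
qed

lemma taylor_coeff_shift:
  assumes "f holomorphic_on ball 0 1"
  shows "taylor_coeff (\<lambda>z. z ^ m * f z) = (\<lambda>n. if n < m then 0 else taylor_coeff f (n - m))"
proof (rule power_series_unit_disk(2))
  fix z :: complex assume "z \<in> ball 0 1"
  then have "(\<lambda>n. z ^ m * (taylor_coeff f n * z ^ n)) sums (z ^ m * f z)"
    by (intro sums_mult taylor_coeff_sums assms)
  then have "(\<lambda>n. (if n + m < m then 0 else taylor_coeff f (n + m - m)) * z ^ (n + m))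
      sums (z ^ m * f z)"
    by (simp add: power_add mult_ac)
  then show "(\<lambda>n. (if n < m then 0 else taylor_coeff f (n - m)) * z ^ n) sums (z ^ m * f z)"
    by (subst (asm) sums_iff_shift) simp
qed

lemma taylor_coeff_power: "taylor_coeff (\<lambda>z. z ^ m) = (\<lambda>n. if n = m then 1 else 0)"
proof (rule power_series_unit_disk(2))
  fix z :: complex
  show "(\<lambda>n. (if n = m then 1 else 0) * z ^ n) sums (z ^ m)"
    using sums_single[of m "\<lambda>n. z ^ n"] by (simp add: if_distrib if_distribR cong: if_cong)
qed

lemma taylor_coeff_poly: "taylor_coeff (poly p) = coeff p"
proof (rule power_series_unit_disk(2))
  fix z :: complex
  show "(\<lambda>n. coeff p n * z ^ n) sums poly p z"
    unfolding poly_altdef atMost_def[symmetric]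
    by (rule sums_finite) (auto simp: coeff_eq_0)
qed

lemma hardy2_holomorphic: "f \<in> hardy2 \<Longrightarrow> f holomorphic_on ball 0 1"
  by (simp add: hardy2_def)

lemma hardy2_summable: "f \<in> hardy2 \<Longrightarrow> summable (\<lambda>n. (cmod (taylor_coeff f n))\<^sup>2)"
  by (simp add: hardy2_def)

lemma hardy2_cong:
  assumes "\<And>z. z \<in> ball 0 1 \<Longrightarrow> f z = g z"
  shows "f \<in> hardy2 \<longleftrightarrow> g \<in> hardy2"
  using holomorphic_cong[OF refl, of "ball 0 1" f g] taylor_coeff_cong[of f g] assms
  by (simp add: hardy2_def)

lemma hardy2_inner_cong:
  assumes "\<And>z. z \<in> ball 0 1 \<Longrightarrow> f z = f' z" "\<And>z. z \<in> ball 0 1 \<Longrightarrow> g z = g' z"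
  shows "hardy2_inner f g = hardy2_inner f' g'"
  using taylor_coeff_cong[of f f'] taylor_coeff_cong[of g g'] assms
  by (simp add: hardy2_inner_def)

section \<open>Norm and inner product in terms of Taylor coefficients\<close>

definition hardy2_norm :: "(complex \<Rightarrow> complex) \<Rightarrow> real" where
  "hardy2_norm f = sqrt (\<Sum>n. (cmod (taylor_coeff f n))\<^sup>2)"

lemma hardy2_norm_nonneg: "f \<in> hardy2 \<Longrightarrow> 0 \<le> hardy2_norm f"
  unfolding hardy2_norm_def by (simp add: suminf_nonneg hardy2_summable)

lemma hardy2_norm_sq: "f \<in> hardy2 \<Longrightarrow> (hardy2_norm f)\<^sup>2 = (\<Sum>n. (cmod (taylor_coeff f n))\<^sup>2)"
  unfolding hardy2_norm_def by (simp add: suminf_nonneg hardy2_summable)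

lemma partial_sum_le_hardy2_norm:
  "f \<in> hardy2 \<Longrightarrow> (\<Sum>n<N. (cmod (taylor_coeff f n))\<^sup>2) \<le> (hardy2_norm f)\<^sup>2"
  by (simp add: hardy2_norm_sq sum_le_suminf hardy2_summable)

lemma hardy2I:
  assumes "f holomorphic_on ball 0 1" "0 \<le> C"
    and "\<And>N. (\<Sum>n<N. (cmod (taylor_coeff f n))\<^sup>2) \<le> C\<^sup>2"
  shows "f \<in> hardy2" and "hardy2_norm f \<le> C"
proof -
  have s: "summable (\<lambda>n. (cmod (taylor_coeff f n))\<^sup>2)"
    by (rule bounded_imp_summable[of _ "C\<^sup>2"])
       (use assms(3)[of "Suc _"] in \<open>simp_all add: lessThan_Suc_atMost\<close>)
  with assms(1) show f: "f \<in> hardy2"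
    by (simp add: hardy2_def)
  have "(hardy2_norm f)\<^sup>2 \<le> C\<^sup>2"
    unfolding hardy2_norm_sq[OF f] by (intro suminf_le_const s assms)
  then show "hardy2_norm f \<le> C"
    using assms(2) power2_le_imp_le by blast
qed

text \<open>The finite inequality bounds all partial sums of moduli by the same product of norms,
  which yields convergence and the estimate together.\<close>

lemma hardy2_Cauchy_Schwarz:
  assumes "f \<in> hardy2" "g \<in> hardy2"
  shows "summable (\<lambda>n. cmod (taylor_coeff f n * cnj (taylor_coeff g n)))"
    and "cmod (hardy2_inner f g) \<le> hardy2_norm f * hardy2_norm g"
proof -
  let ?t = "\<lambda>n. cmod (taylor_coeff f n * cnj (taylor_coeff g n))"
  have le: "(\<Sum>n<N. ?t n) \<le> hardy2_norm f * hardy2_norm g" for N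
  proof (rule power2_le_imp_le)
    have "(\<Sum>n<N. ?t n)\<^sup>2 = (\<Sum>n<N. cmod (taylor_coeff f n) * cmod (taylor_coeff g n))\<^sup>2"
      by (simp add: norm_mult)
    also have "\<dots> \<le> (\<Sum>n<N. (cmod (taylor_coeff f n))\<^sup>2) * (\<Sum>n<N. (cmod (taylor_coeff g n))\<^sup>2)"
      by (rule Cauchy_Schwarz_ineq_sum)
    also have "\<dots> \<le> (hardy2_norm f)\<^sup>2 * (hardy2_norm g)\<^sup>2"
      by (intro mult_mono partial_sum_le_hardy2_norm assms sum_nonneg) auto
    finally show "(\<Sum>n<N. ?t n)\<^sup>2 \<le> (hardy2_norm f * hardy2_norm g)\<^sup>2"
      by (simp add: power_mult_distrib)
  qed (simp add: hardy2_norm_nonneg assms)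
  then have "(\<Sum>n\<le>N. ?t n) \<le> hardy2_norm f * hardy2_norm g" for N
    by (metis lessThan_Suc_atMost)
  then show s: "summable ?t"
    by (intro bounded_imp_summable[of _ "hardy2_norm f * hardy2_norm g"]) simp_all
  have "cmod (hardy2_inner f g) \<le> (\<Sum>n. ?t n)"
    unfolding hardy2_inner_def by (rule summable_norm[OF s])
  also have "\<dots> \<le> hardy2_norm f * hardy2_norm g"
    by (intro suminf_le_const s le)
  finally show "cmod (hardy2_inner f g) \<le> hardy2_norm f * hardy2_norm g" .
qed

lemma hardy2_inner_sums:
  assumes "f \<in> hardy2" "g \<in> hardy2"
  shows "(\<lambda>n. taylor_coeff f n * cnj (taylor_coeff g n)) sums hardy2_inner f g"
  unfolding hardy2_inner_def
  by (rule summable_sums[OF summable_norm_cancel[OF hardy2_Cauchy_Schwarz(1)[OF assms]]])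

lemma hardy2_inner_self:
  assumes "f \<in> hardy2"
  shows "hardy2_inner f f = complex_of_real ((hardy2_norm f)\<^sup>2)"
  unfolding hardy2_inner_def hardy2_norm_sq[OF assms]
  by (simp add: complex_norm_square[symmetric] suminf_of_real hardy2_summable assms)

lemma hardy2_inner_commute:
  assumes "f \<in> hardy2" "g \<in> hardy2"
  shows "hardy2_inner f g = cnj (hardy2_inner g f)"
proof -
  have "(\<lambda>n. cnj (taylor_coeff g n * cnj (taylor_coeff f n))) sums cnj (hardy2_inner g f)"
    by (subst sums_cnj) (rule hardy2_inner_sums[OF assms(2,1)])
  then show ?thesis
    by (simp add: hardy2_inner_def sums_iff mult.commute)
qed

lemma hardy2_cmult:
  assumes "f \<in> hardy2"
  shows "(\<lambda>z. c * f z) \<in> hardy2"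
  using assms unfolding hardy2_def
  by (auto simp: taylor_coeff_cmult norm_mult power_mult_distrib
      intro!: holomorphic_intros summable_mult)

lemma hardy2_norm_cmult:
  assumes "f \<in> hardy2"
  shows "hardy2_norm (\<lambda>z. c * f z) = cmod c * hardy2_norm f"
  by (simp add: hardy2_norm_def taylor_coeff_cmult hardy2_holomorphic norm_mult
      power_mult_distrib suminf_mult hardy2_summable assms real_sqrt_mult)

lemma hardy2_add:
  assumes "f \<in> hardy2" "g \<in> hardy2"
  shows "(\<lambda>z. f z + g z) \<in> hardy2"
proof -
  have "summable (\<lambda>n. 2 * (cmod (taylor_coeff f n))\<^sup>2 + 2 * (cmod (taylor_coeff g n))\<^sup>2)"
    by (intro summable_add summable_mult hardy2_summable assms)
  then have "summable (\<lambda>n. (cmod (taylor_coeff f n + taylor_coeff g n))\<^sup>2)"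
  proof (rule summable_comparison_test')
    fix n :: nat
    let ?x = "taylor_coeff f n" and ?y = "taylor_coeff g n"
    have "(cmod (?x + ?y))\<^sup>2 \<le> (cmod ?x + cmod ?y)\<^sup>2"
      by (intro power_mono norm_triangle_ineq) auto
    also have "\<dots> \<le> 2 * (cmod ?x)\<^sup>2 + 2 * (cmod ?y)\<^sup>2"
      using sum_squares_ge_zero[of "cmod ?x - cmod ?y" 0] by (simp add: power2_eq_square algebra_simps)
    finally show "norm ((cmod (?x + ?y))\<^sup>2) \<le> 2 * (cmod ?x)\<^sup>2 + 2 * (cmod ?y)\<^sup>2"
      by simp
  qed
  with assms show ?thesis
    by (auto simp: hardy2_def taylor_coeff_add intro!: holomorphic_intros)
qed

lemma hardy2_power: "(\<lambda>z. z ^ m) \<in> hardy2"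
proof -
  have "summable (\<lambda>n. (cmod (taylor_coeff (\<lambda>z. z ^ m) n))\<^sup>2)"
    by (rule summable_finite[of "{m}"]) (auto simp: taylor_coeff_power)
  then show ?thesis
    by (auto simp: hardy2_def intro!: holomorphic_intros)
qed

lemma hardy2_shift:
  assumes "f \<in> hardy2"
  shows "(\<lambda>z. z ^ m * f z) \<in> hardy2"
proof -
  have "summable (\<lambda>n. (cmod (if n < m then 0 else taylor_coeff f (n - m)))\<^sup>2)"
    by (subst summable_iff_shift[of _ m, symmetric]) (simp add: hardy2_summable assms)
  with assms show ?thesis
    by (auto simp: hardy2_def taylor_coeff_shift intro!: holomorphic_intros)
qed

lemma hardy2_sum:
  assumes "finite A" "\<And>i. i \<in> A \<Longrightarrow> f i \<in> hardy2"
  shows "(\<lambda>z. \<Sum>i\<in>A. f i z) \<in> hardy2"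
  using assms
proof (induction A rule: finite_induct)
  case empty
  show ?case
    using hardy2_cmult[OF hardy2_power[of 0], of 0] by simp
next
  case (insert x A)
  then show ?case
    using hardy2_add[of "f x" "\<lambda>z. \<Sum>i\<in>A. f i z"] by simp
qed

lemma hardy2_inner_add_left:
  assumes "f \<in> hardy2" "g \<in> hardy2" "h \<in> hardy2"
  shows "hardy2_inner (\<lambda>z. f z + g z) h = hardy2_inner f h + hardy2_inner g h"
  using sums_add[OF hardy2_inner_sums[OF assms(1,3)] hardy2_inner_sums[OF assms(2,3)]] assms
  by (simp add: hardy2_inner_def[of "\<lambda>z. f z + g z"] taylor_coeff_add hardy2_holomorphic distrib_right sums_iff)

lemma hardy2_inner_cmult_left:
  assumes "f \<in> hardy2" "h \<in> hardy2"
  shows "hardy2_inner (\<lambda>z. c * f z) h = c * hardy2_inner f h"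
  using sums_mult[OF hardy2_inner_sums[OF assms], of c] assms
  by (simp add: hardy2_inner_def[of "\<lambda>z. c * f z"] taylor_coeff_cmult hardy2_holomorphic mult.assoc sums_iff)

lemma hardy2_inner_sum_left:
  assumes "finite A" "\<And>i. i \<in> A \<Longrightarrow> f i \<in> hardy2" "h \<in> hardy2"
  shows "hardy2_inner (\<lambda>z. \<Sum>i\<in>A. f i z) h = (\<Sum>i\<in>A. hardy2_inner (f i) h)"
proof -
  have "(\<lambda>n. \<Sum>i\<in>A. taylor_coeff (f i) n * cnj (taylor_coeff h n))
      sums (\<Sum>i\<in>A. hardy2_inner (f i) h)"
    by (intro sums_sum hardy2_inner_sums assms)
  with assms show ?thesis
    by (simp add: hardy2_inner_def[of "\<lambda>z. \<Sum>i\<in>A. f i z"] taylor_coeff_sum hardy2_holomorphic sum_distrib_right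
        sums_iff)
qed

lemma hardy2_inner_sum_right:
  assumes "finite A" "\<And>i. i \<in> A \<Longrightarrow> f i \<in> hardy2" "h \<in> hardy2"
  shows "hardy2_inner h (\<lambda>z. \<Sum>i\<in>A. f i z) = (\<Sum>i\<in>A. hardy2_inner h (f i))"
  using hardy2_inner_sum_left[OF assms] assms
    hardy2_inner_commute[OF assms(3) hardy2_sum[OF assms(1,2)]]
  by (simp add: hardy2_inner_commute[OF assms(3) assms(2)] )

lemma hardy2_inner_cmult_right:
  assumes "f \<in> hardy2" "h \<in> hardy2"
  shows "hardy2_inner h (\<lambda>z. c * f z) = cnj c * hardy2_inner h f"
  using hardy2_inner_cmult_left[OF assms, of c] hardy2_inner_commute[OF assms(2) hardy2_cmult[OF assms(1)]]
    hardy2_inner_commute[OF assms(2,1)]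
  by simp

lemma hardy2_inner_shift:
  assumes "f \<in> hardy2" "g \<in> hardy2"
  shows "hardy2_inner (\<lambda>z. z ^ m * f z) (\<lambda>z. z ^ m * g z) = hardy2_inner f g"
proof -
  have "(\<lambda>n. (if n < m then 0 else taylor_coeff f (n - m)) *
      cnj (if n < m then 0 else taylor_coeff g (n - m))) sums hardy2_inner f g"
    using sums_iff_shift[of "\<lambda>n. (if n < m then 0 else taylor_coeff f (n - m)) *
      cnj (if n < m then 0 else taylor_coeff g (n - m))" m "hardy2_inner f g"]
      hardy2_inner_sums[OF assms] by simp
  with assms show ?thesis
    by (simp add: hardy2_inner_def[of "\<lambda>z. z ^ m * f z"] taylor_coeff_shift hardy2_holomorphic sums_iff)
qed

lemma hardy2_inner_power:
  assumes "f \<in> hardy2"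
  shows "hardy2_inner f (\<lambda>z. z ^ m) = taylor_coeff f m"
  unfolding hardy2_inner_def taylor_coeff_power
  using suminf_finite[of "{m}" "\<lambda>n. taylor_coeff f n * cnj (if n = m then 1 else 0)"] by simp

section \<open>The Szego kernel, called \<open>K w\<close> in the overview\<close>

definition szego :: "complex \<Rightarrow> complex \<Rightarrow> complex" where
  "szego w z = 1 / (1 - cnj w * z)"

lemma szego_denominator:
  assumes "w \<in> ball 0 1" "z \<in> ball 0 1"
  shows "cmod (cnj w * z) < 1" and "1 - cnj w * z \<noteq> 0"
proof -
  have "cmod w * cmod z < 1 * 1"
    using assms by (intro mult_strict_mono') auto
  then show *: "cmod (cnj w * z) < 1"
    by (simp add: norm_mult)
  then show "1 - cnj w * z \<noteq> 0" 
    by (metis eq_iff_diff_eq_0 norm_one order_less_irrefl)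
qed

lemma
  assumes "w \<in> ball 0 1"
  shows szego_holomorphic: "szego w holomorphic_on ball 0 1"
    and taylor_coeff_szego: "taylor_coeff (szego w) = (\<lambda>n. cnj w ^ n)"
proof -
  have *: "(\<lambda>n. cnj w ^ n * z ^ n) sums szego w z" if "z \<in> ball 0 1" for z
    using geometric_sums[OF szego_denominator(1)[OF assms that]]
    by (simp add: szego_def power_mult_distrib)
  show "szego w holomorphic_on ball 0 1" "taylor_coeff (szego w) = (\<lambda>n. cnj w ^ n)"
    using power_series_unit_disk[OF *] by auto
qed

lemma hardy2_szego:
  assumes "w \<in> ball 0 1"
  shows "szego w \<in> hardy2"
    and "(hardy2_norm (szego w))\<^sup>2 = 1 / (1 - (cmod w)\<^sup>2)"
proof -
  have "(cmod w)\<^sup>2 < 1"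
    using assms by (simp add: power_less_one_iff)
  then have *: "(\<lambda>n. (cmod (taylor_coeff (szego w) n))\<^sup>2) sums (1 / (1 - (cmod w)\<^sup>2))"
    using geometric_sums[of "(cmod w)\<^sup>2"]
    by (simp add: taylor_coeff_szego[OF assms] norm_power power_mult[symmetric] mult.commute)
  then show k: "szego w \<in> hardy2"
    using szego_holomorphic[OF assms] by (simp add: hardy2_def sums_iff)
  show "(hardy2_norm (szego w))\<^sup>2 = 1 / (1 - (cmod w)\<^sup>2)"
    using * by (simp add: hardy2_norm_sq k sums_iff)
qed

lemma szego_self:
  assumes "w \<in> ball 0 1"
  shows "szego w w = complex_of_real ((hardy2_norm (szego w))\<^sup>2)"
  unfolding hardy2_szego(2)[OF assms]
  by (simp add: szego_def complex_norm_square[symmetric] mult.commute)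

lemma hardy2_norm_szego_pos:
  assumes "w \<in> ball 0 1"
  shows "0 < hardy2_norm (szego w)"
proof -
  have "(cmod w)\<^sup>2 < 1"
    using assms by (simp add: power_less_one_iff)
  then have "(hardy2_norm (szego w))\<^sup>2 \<noteq> 0"
    unfolding hardy2_szego(2)[OF assms] by simp
  with hardy2_norm_nonneg[OF hardy2_szego(1)[OF assms]] show ?thesis
    by (metis order_le_less zero_power2)
qed

text \<open>The coefficients \<open>cnj w ^ n\<close> of the kernel turn the inner product into the
  power series of \<open>f\<close> at \<open>w\<close>.\<close>

lemma hardy2_inner_szego:
  assumes "f \<in> hardy2" "w \<in> ball 0 1"
  shows "hardy2_inner f (szego w) = f w"
  using taylor_coeff_sums[OF hardy2_holomorphic[OF assms(1)] assms(2)]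
  by (simp add: hardy2_inner_def taylor_coeff_szego[OF assms(2)] sums_iff)

lemma hardy2_pointwise_bound:
  assumes "f \<in> hardy2" "w \<in> ball 0 1"
  shows "cmod (f w) \<le> hardy2_norm f * hardy2_norm (szego w)"
  using hardy2_Cauchy_Schwarz(2)[OF assms(1) hardy2_szego(1)[OF assms(2)]]
  by (simp only: hardy2_inner_szego[OF assms])

section \<open>Parseval on circles and bounded multipliers\<close>

abbreviation circle_measure :: "real measure" where
  "circle_measure \<equiv> lebesgue_on {0..2 * pi}"

lemma integral_circle_const: "(LINT t|circle_measure. c) = (2 * pi) *\<^sub>R (c :: 'a :: euclidean_space)"
  by (subst lebesgue_integral_eq_integral) auto

lemma integral_circle_const_of_real: "(LINT t|circle_measure. (c :: real)) = 2 * pi * c"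
  using integral_circle_const[of c] by simp

lemma continuous_cis_power: "continuous_on S (\<lambda>t. cis t ^ n)"
  by (auto simp: cis_conv_exp intro!: continuous_intros)

lemma measurable_cis_power [measurable]: "(\<lambda>t. cis t ^ n) \<in> borel_measurable circle_measure"
  by (intro continuous_imp_measurable_on_sets_lebesgue continuous_cis_power) auto

lemma cnj_measurable [measurable]:
  "f \<in> borel_measurable M \<Longrightarrow> (\<lambda>x. cnj (f x)) \<in> borel_measurable M"
  by (rule borel_measurable_continuous_on) (auto intro: continuous_intros)

lemma integrable_circle_bounded:
  fixes f :: "real \<Rightarrow> complex"
  assumes "f \<in> borel_measurable circle_measure" "\<And>t. cmod (f t) \<le> C"
  shows "integrable circle_measure f"
  by (rule Bochner_Integration.integrable_bound[of _ "\<lambda>_. C"])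
     (use assms in \<open>auto intro: order_trans[OF _ abs_ge_self]\<close>)

lemma integral_circle_characters:
  "(LINT t|circle_measure. cis t ^ n * cnj (cis t ^ m)) = (if n = m then 2 * pi else 0)"
proof (cases "n = m")
  case True
  have "cis t ^ m * cnj (cis t ^ m) = 1" for t
    using complex_norm_square[of "cis t ^ m"] by (simp add: norm_power)
  with True integral_circle_const[of "1 :: complex"] show ?thesis
    by (simp add: scaleR_conv_of_real)
next
  case False
  define k where "k = int n - int m"
  have k0: "complex_of_int k \<noteq> 0"
    using False by (simp add: k_def)
  have eq: "cis t ^ n * cnj (cis t ^ m) = exp (\<i> * of_int k * of_real t)" for t
  proof -
    have "cis t ^ n * cnj (cis t ^ m) = cis (real n * t) * cis (- (real m * t))"
      by (simp only: Complex.DeMoivre cis_cnj)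
    also have "\<dots> = cis (of_int k * t)"
      by (simp add: cis_mult k_def algebra_simps)
    finally show ?thesis
      by (simp add: cis_conv_exp mult_ac)
  qed
  have "((\<lambda>t. exp (\<i> * of_int k * of_real t)) has_integral
      (exp (\<i> * of_int k * of_real (2 * pi)) / (\<i> * of_int k) -
       exp (\<i> * of_int k * of_real 0) / (\<i> * of_int k))) {0..2 * pi}"
  proof (rule fundamental_theorem_of_calculus)
    fix t :: real
    have "((\<lambda>z. exp (\<i> * of_int k * z) / (\<i> * of_int k)) has_field_derivative
        exp (\<i> * of_int k * of_real t)) (at (of_real t))"
      using k0 by (auto intro!: derivative_eq_intros)
    then show "((\<lambda>t. exp (\<i> * of_int k * of_real t) / (\<i> * of_int k)) has_vector_derivative
        exp (\<i> * of_int k * of_real t)) (at t within {0..2 * pi})"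
      by (rule has_vector_derivative_real_field)
  qed simp
  moreover have "exp (\<i> * of_int k * of_real (2 * pi)) = 1"
    using exp_plus_2pin[of 0 k] by (simp add: mult_ac)
  ultimately have I: "((\<lambda>t. cis t ^ n * cnj (cis t ^ m)) has_integral 0) {0..2 * pi}"
    unfolding eq by simp
  have "integrable circle_measure (\<lambda>t. cis t ^ n * cnj (cis t ^ m))"
    by (rule integrable_circle_bounded[of _ 1]) (measurable, simp add: norm_mult norm_power)
  then have "(LINT t|circle_measure. cis t ^ n * cnj (cis t ^ m)) =
      integral {0..2 * pi} (\<lambda>t. cis t ^ n * cnj (cis t ^ m))"
    by (rule lebesgue_integral_eq_integral) simp
  with I False show ?thesis
    by (simp add: integral_unique)
qed

text \<open>Only dilates \<open>f (r * cis t)\<close> with \<open>r < 1\<close> and their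
  differences are expanded in this way. Their coefficients are absolutely summable, which justifies
  every exchange of sum and integral.\<close>

definition circle_series :: "(nat \<Rightarrow> complex) \<Rightarrow> real \<Rightarrow> complex" where
  "circle_series c t = (\<Sum>n. c n * cis t ^ n)"

lemma summable_circle_series:
  assumes "summable (\<lambda>n. cmod (c n))"
  shows "summable (\<lambda>n. cmod (c n * cis t ^ n))" and "summable (\<lambda>n. c n * cis t ^ n)"
proof -
  show "summable (\<lambda>n. cmod (c n * cis t ^ n))"
    using assms by (simp add: norm_mult norm_power)
  then show "summable (\<lambda>n. c n * cis t ^ n)"
    by (rule summable_norm_cancel)
qed

lemma circle_series_measurable [measurable]: "circle_series c \<in> borel_measurable circle_measure"
  unfolding circle_series_def[abs_def] by measurable

lemma circle_series_bound:
  assumes "summable (\<lambda>n. cmod (c n))"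
  shows "cmod (circle_series c t) \<le> (\<Sum>n. cmod (c n))"
  using summable_norm[OF summable_circle_series(1)[OF assms]]
  by (simp add: circle_series_def norm_mult norm_power)

lemma circle_series_fourier_coeff:
  fixes c :: "nat \<Rightarrow> complex"
  assumes "summable (\<lambda>n. cmod (c n))"
  shows "(LINT t|circle_measure. circle_series c t * cnj (cis t ^ m)) = 2 * pi * c m"
proof -
  let ?f = "\<lambda>n t. c n * cis t ^ n * cnj (cis t ^ m)"
  have norm: "cmod (?f n t) = cmod (c n)" for n t
    by (simp add: norm_mult norm_power)
  have int: "(LINT t|circle_measure. ?f n t) = (if n = m then 2 * pi * c m else 0)" for n
    using integral_circle_characters[of n m] by (simp add: mult.assoc)
  have "(\<lambda>n. LINT t|circle_measure. ?f n t) sums (LINT t|circle_measure. (\<Sum>n. ?f n t))"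
  proof (rule sums_integral)
    show "integrable circle_measure (?f n)" for n
      by (rule integrable_circle_bounded[of _ "cmod (c n)"]) (simp_all only: norm order_refl, measurable)
  qed (simp_all only: norm integral_circle_const_of_real summable_mult assms AE_I2)
  moreover have "(\<lambda>n. LINT t|circle_measure. ?f n t) sums (2 * pi * c m)"
    unfolding int using sums_single[of m "\<lambda>_. 2 * pi * c m"] by simp
  moreover have "(\<Sum>n. ?f n t) = circle_series c t * cnj (cis t ^ m)" for t
    unfolding circle_series_def
    by (rule suminf_mult2[symmetric]) (rule summable_circle_series(2)[OF assms])
  ultimately show ?thesis
    using sums_unique2 by auto
qed

text \<open>Only the second factor is expanded. The first stays a bounded function, so a single
  exchange of sum and integral reduces the claim to its Fourier coefficients.\<close>

lemma circle_series_Parseval: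
  assumes c: "summable (\<lambda>n. cmod (c n))" and d: "summable (\<lambda>n. cmod (d n))"
  shows "(\<lambda>n. 2 * pi * (c n * cnj (d n))) sums
    (LINT t|circle_measure. circle_series c t * cnj (circle_series d t))"
proof -
  let ?C = "\<Sum>n. cmod (c n)"
  let ?f = "\<lambda>n t. circle_series c t * cnj (d n * cis t ^ n)"
  have C: "cmod (circle_series c t) \<le> ?C" for t
    by (rule circle_series_bound[OF c])
  have norm: "cmod (?f n t) \<le> ?C * cmod (d n)" for n t
    using mult_right_mono[OF C, of "cmod (d n)"] by (simp add: norm_mult norm_power)
  have "(\<lambda>n. LINT t|circle_measure. ?f n t) sums (LINT t|circle_measure. (\<Sum>n. ?f n t))"
  proof (rule sums_integral)
    show int: "integrable circle_measure (?f n)" for n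
      by (rule integrable_circle_bounded[of _ "?C * cmod (d n)"]) (simp_all only: norm, measurable)
    show "AE t in circle_measure. summable (\<lambda>n. cmod (?f n t))"
      by (intro AE_I2 summable_comparison_test'[OF summable_mult[OF d, of ?C]])
         (simp only: norm real_norm_def abs_norm_cancel)
    show "summable (\<lambda>n. LINT t|circle_measure. cmod (?f n t))"
    proof (rule summable_comparison_test')
      show "summable (\<lambda>n. 2 * pi * (?C * cmod (d n)))"
        by (intro summable_mult d)
      fix n :: nat
      have "(LINT t|circle_measure. cmod (?f n t)) \<le> (LINT t|circle_measure. ?C * cmod (d n))"
        by (intro integral_mono integrable_norm int norm) auto
      also have "\<dots> = 2 * pi * (?C * cmod (d n))"
        by (rule integral_circle_const_of_real)
      finally show "norm (LINT t|circle_measure. cmod (?f n t)) \<le> 2 * pi * (?C * cmod (d n))"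
        by simp
    qed
  qed
  moreover have "(LINT t|circle_measure. ?f n t) = 2 * pi * (c n * cnj (d n))" for n
  proof -
    have "(LINT t|circle_measure. ?f n t) =
        (LINT t|circle_measure. circle_series c t * cnj (cis t ^ n) * cnj (d n))"
      by (simp add: mult_ac)
    also have "\<dots> = 2 * pi * c n * cnj (d n)"
      by (simp add: circle_series_fourier_coeff[OF c] flip: complex_cnj_power)
    finally show ?thesis
      by (simp add: mult.assoc)
  qed
  moreover have "(\<Sum>n. ?f n t) = circle_series c t * cnj (circle_series d t)" for t
  proof -
    have "(\<lambda>n. d n * cis t ^ n) sums circle_series d t"
      unfolding circle_series_def by (rule summable_sums[OF summable_circle_series(2)[OF d]])
    then have "(\<lambda>n. circle_series c t * cnj (d n * cis t ^ n)) sums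
        (circle_series c t * cnj (circle_series d t))"
      by (intro sums_mult) (simp only: sums_cnj)
    then show ?thesis
      by (simp add: sums_iff)
  qed
  ultimately show ?thesis
    by simp
qed

lemma circle_series_norm:
  assumes c: "summable (\<lambda>n. cmod (c n))"
  shows "integrable circle_measure (\<lambda>t. (cmod (circle_series c t))\<^sup>2)"
    and "(\<lambda>n. 2 * pi * (cmod (c n))\<^sup>2) sums (LINT t|circle_measure. (cmod (circle_series c t))\<^sup>2)"
proof -
  show "integrable circle_measure (\<lambda>t. (cmod (circle_series c t))\<^sup>2)"
  proof (rule Bochner_Integration.integrable_bound[of _ "\<lambda>_. (\<Sum>n. cmod (c n))\<^sup>2"])
    show "AE t in circle_measure. norm ((cmod (circle_series c t))\<^sup>2) \<le> norm ((\<Sum>n. cmod (c n))\<^sup>2)"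
      by (intro AE_I2) (simp add: power_mono circle_series_bound[OF c])
  qed auto
  have "(LINT t|circle_measure. circle_series c t * cnj (circle_series c t)) =
      complex_of_real (LINT t|circle_measure. (cmod (circle_series c t))\<^sup>2)"
    by (simp add: complex_norm_square[symmetric] flip: of_real_power)
  moreover have "2 * complex_of_real pi * (c n * cnj (c n)) = complex_of_real (2 * pi * (cmod (c n))\<^sup>2)" for n
    by (simp add: complex_norm_square[symmetric])
  ultimately have "(\<lambda>n. complex_of_real (2 * pi * (cmod (c n))\<^sup>2)) sums
      complex_of_real (LINT t|circle_measure. (cmod (circle_series c t))\<^sup>2)"
    using circle_series_Parseval[OF c c] by simp
  then show "(\<lambda>n. 2 * pi * (cmod (c n))\<^sup>2) sums (LINT t|circle_measure. (cmod (circle_series c t))\<^sup>2)"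
    by (rule sums_of_real_iff[THEN iffD1])
qed

lemma holomorphic_circle_series:
  assumes f: "f holomorphic_on ball 0 1" and r: "0 \<le> r" "r < 1"
  shows "summable (\<lambda>n. cmod (taylor_coeff f n * of_real r ^ n))"
    and "f (of_real r * cis t) = circle_series (\<lambda>n. taylor_coeff f n * of_real r ^ n) t"
proof -
  \<comment> \<open>A point strictly between \<open>r\<close> and \<open>1\<close>: convergence at
    \<open>s\<close> forces absolute convergence at \<open>r\<close>.\<close>
  define s where "s = (1 + r) / 2"
  have "summable (\<lambda>n. taylor_coeff f n * complex_of_real s ^ n)"
    by (rule sums_summable[OF taylor_coeff_sums[OF f]])
       (use r in \<open>simp add: s_def del: of_real_add of_real_divide\<close>)
  then show "summable (\<lambda>n. cmod (taylor_coeff f n * of_real r ^ n))"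
    by (rule powser_insidea) (use r in \<open>simp add: s_def del: of_real_add of_real_divide\<close>)
  have "(\<lambda>n. taylor_coeff f n * (complex_of_real r * cis t) ^ n) sums f (of_real r * cis t)"
    by (rule taylor_coeff_sums[OF f]) (use r in \<open>auto simp: norm_mult\<close>)
  then show "f (of_real r * cis t) = circle_series (\<lambda>n. taylor_coeff f n * of_real r ^ n) t"
    by (simp add: circle_series_def sums_iff power_mult_distrib mult.assoc)
qed

text \<open>On each circle of radius \<open>r < 1\<close>, Parseval turns the pointwise bound on
  \<open>F\<close> into a bound on coefficients. The limit \<open>r \<rightarrow> 1\<close> is taken
  in finite partial sums only, where it is harmless.\<close>

lemma
  assumes F: "F holomorphic_on ball 0 1" "\<And>z. z \<in> ball 0 1 \<Longrightarrow> cmod (F z) \<le> 1"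
    and h: "h \<in> hardy2"
  shows hardy2_bounded_mult: "(\<lambda>z. F z * h z) \<in> hardy2"
    and hardy2_norm_bounded_mult: "hardy2_norm (\<lambda>z. F z * h z) \<le> hardy2_norm h"
proof -
  let ?g = "\<lambda>z. F z * h z"
  have hh: "h holomorphic_on ball 0 1"
    by (rule hardy2_holomorphic[OF h])
  have g: "?g holomorphic_on ball 0 1"
    by (intro holomorphic_intros F hh)
  have le: "(\<Sum>n<N. (cmod (taylor_coeff ?g n))\<^sup>2 * r ^ (2 * n)) \<le> (hardy2_norm h)\<^sup>2"
    if r: "0 \<le> r" "r < 1" for r N
  proof -
    let ?u = "\<lambda>t. complex_of_real r * cis t"
    have cg: "(\<lambda>n. 2 * pi * (cmod (taylor_coeff ?g n * of_real r ^ n))\<^sup>2) sums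
        (LINT t|circle_measure. (cmod (?g (?u t)))\<^sup>2)"
      and ig: "integrable circle_measure (\<lambda>t. (cmod (?g (?u t)))\<^sup>2)"
      using circle_series_norm[OF holomorphic_circle_series(1)[OF g r]]
      unfolding holomorphic_circle_series(2)[OF g r] by auto
    have ch: "(\<lambda>n. 2 * pi * (cmod (taylor_coeff h n * of_real r ^ n))\<^sup>2) sums
        (LINT t|circle_measure. (cmod (h (?u t)))\<^sup>2)"
      and ih: "integrable circle_measure (\<lambda>t. (cmod (h (?u t)))\<^sup>2)"
      using circle_series_norm[OF holomorphic_circle_series(1)[OF hh r]]
      unfolding holomorphic_circle_series(2)[OF hh r] by auto
    have "2 * pi * (\<Sum>n<N. (cmod (taylor_coeff ?g n))\<^sup>2 * r ^ (2 * n)) =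
        (\<Sum>n<N. 2 * pi * (cmod (taylor_coeff ?g n * of_real r ^ n))\<^sup>2)"
      using r by (simp add: sum_distrib_left norm_mult norm_power power_mult_distrib
          power_mult[symmetric] mult.commute[of 2])
    also have "\<dots> \<le> (LINT t|circle_measure. (cmod (?g (?u t)))\<^sup>2)"
      using cg by (intro sum_le_suminf[THEN order_trans]) (auto simp: sums_iff)
    also have "\<dots> \<le> (LINT t|circle_measure. (cmod (h (?u t)))\<^sup>2)"
    proof (intro integral_mono ig ih power_mono)
      fix t
      have "cmod (F (?u t)) \<le> 1"
        using r by (intro F(2)) (simp add: norm_mult)
      then show "cmod (?g (?u t)) \<le> cmod (h (?u t))"
        by (simp add: norm_mult mult_left_le_one_le)
    qed auto
    also have "\<dots> = (\<Sum>n. 2 * pi * (cmod (taylor_coeff h n * of_real r ^ n))\<^sup>2)"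
      using ch by (simp add: sums_iff)
    also have "\<dots> \<le> (\<Sum>n. 2 * pi * (cmod (taylor_coeff h n))\<^sup>2)"
    proof (rule suminf_le)
      fix n
      have "cmod (taylor_coeff h n * of_real r ^ n) \<le> cmod (taylor_coeff h n)"
        using r by (simp add: norm_mult norm_power mult_right_le_one_le power_le_one)
      then show "2 * pi * (cmod (taylor_coeff h n * of_real r ^ n))\<^sup>2 \<le> 2 * pi * (cmod (taylor_coeff h n))\<^sup>2"
        by (intro mult_left_mono power_mono) auto
    qed (use ch in \<open>auto simp: sums_iff intro!: summable_mult hardy2_summable h\<close>)
    also have "\<dots> = 2 * pi * (hardy2_norm h)\<^sup>2"
      by (simp add: suminf_mult hardy2_summable hardy2_norm_sq h)
    finally show ?thesis
      by simp
  qed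
  have "(\<Sum>n<N. (cmod (taylor_coeff ?g n))\<^sup>2) \<le> (hardy2_norm h)\<^sup>2" for N
  proof (rule tendsto_upperbound)
    show "((\<lambda>r. \<Sum>n<N. (cmod (taylor_coeff ?g n))\<^sup>2 * r ^ (2 * n)) \<longlongrightarrow>
        (\<Sum>n<N. (cmod (taylor_coeff ?g n))\<^sup>2)) (at_left 1)"
      by (rule tendsto_eq_intros refl | simp)+
    have "\<forall>\<^sub>F r in at_left (1 :: real). r \<in> {0<..<1}"
      by (rule eventually_at_leftI[of 0]) auto
    then show "\<forall>\<^sub>F r in at_left 1. (\<Sum>n<N. (cmod (taylor_coeff ?g n))\<^sup>2 * r ^ (2 * n)) \<le> (hardy2_norm h)\<^sup>2"
      by eventually_elim (rule le, auto)
  qed simp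
  from hardy2I[OF g hardy2_norm_nonneg[OF h] this]
  show "?g \<in> hardy2" "hardy2_norm ?g \<le> hardy2_norm h"
    by auto
qed

section \<open>Inner functions\<close>

text \<open>The Fourier coefficients of \<open>|F|\<^sup>2\<close> on the circle, expressed through the Taylor coefficients of
  \<open>F\<close>; the condition says that \<open>|F| = 1\<close> almost everywhere there.\<close>

definition algebraic_inner :: "(complex \<Rightarrow> complex) \<Rightarrow> bool" where
  "algebraic_inner F \<longleftrightarrow> F \<in> hardy2 \<and>
     (\<forall>m. hardy2_inner F (\<lambda>z. z ^ m * F z) = (if m = 0 then 1 else 0))"

text \<open>With \<open>d = cmod (u - l)\<close> the left side is at most
  \<open>d * (d + 2)\<close>, and \<open>2 * d \<le> d\<^sup>2 / \<epsilon> + \<epsilon>\<close>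
  removes the linear term. Thus a bound on the squared distance to the boundary values controls the
  integral of the left side up to a multiple of \<open>\<epsilon>\<close>.\<close>

lemma abs_norm_sq_diff_1_le:
  fixes u l :: complex
  assumes "cmod l = 1" "0 < \<epsilon>"
  shows "\<bar>(cmod u)\<^sup>2 - 1\<bar> \<le> (1 + 1 / \<epsilon>) * (cmod (u - l))\<^sup>2 + \<epsilon>"
proof -
  define d where "d = cmod (u - l)"
  have d: "\<bar>cmod u - 1\<bar> \<le> d" "0 \<le> d"
    using norm_triangle_ineq3[of u l] assms by (auto simp: d_def)
  have "\<bar>(cmod u)\<^sup>2 - 1\<bar> = \<bar>cmod u - 1\<bar> * (cmod u + 1)"
    by (simp add: power2_eq_square square_diff_one_factored abs_mult mult.commute)
  also have "\<dots> \<le> d * (d + 2)"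
    using d by (intro mult_mono) auto
  also have "\<dots> \<le> (1 + 1 / \<epsilon>) * d\<^sup>2 + \<epsilon>"
  proof -
    have "0 \<le> (d - \<epsilon>)\<^sup>2 / \<epsilon>"
      using assms by simp
    also have "\<dots> = d\<^sup>2 / \<epsilon> - 2 * d + \<epsilon>"
      using assms by (simp add: power2_eq_square field_simps)
    finally show ?thesis
      by (simp add: power2_eq_square algebra_simps)
  qed
  finally show ?thesis
    by (simp add: d_def)
qed

text \<open>The domination by squared coefficients behind the summability of the error series and
  the use of Tannery's theorem on it.\<close>

lemma one_minus_power_damping:
  fixes x c :: real
  assumes "0 \<le> x" "x < 1"
  shows "norm (c\<^sup>2 * (1 - x ^ n)\<^sup>2) \<le> c\<^sup>2"
proof -
  have "x ^ n \<le> 1" "0 \<le> x ^ n"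
    using assms by (auto intro: power_le_one)
  then have "\<bar>1 - x ^ n\<bar> \<le> 1"
    by simp
  then show ?thesis
    by (simp add: abs_square_le_1 mult_left_le)
qed

text \<open>The dilates of an inner function converge in \<open>L\<^sup>2\<close> to the radial limit, because Fatou's lemma
  passes the \<open>L\<^sup>2\<close> Cauchy estimate for the dilates to their almost everywhere limit.\<close>

lemma inner_function_boundary_estimate:
  assumes inner: "inner_function \<Theta>" and r: "\<And>k. 0 \<le> r k" "\<And>k. r k < 1" "r \<longlonglongrightarrow> 1" "incseq r"
    and \<epsilon>: "0 < \<epsilon>"
  shows "(LINT t|circle_measure. \<bar>(cmod (\<Theta> (of_real (r j) * cis t)))\<^sup>2 - 1\<bar>) \<le>
    (1 + 1 / \<epsilon>) * (2 * pi * (\<Sum>n. (cmod (taylor_coeff \<Theta> n))\<^sup>2 * (1 - r j ^ n)\<^sup>2)) + 2 * pi * \<epsilon>"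
proof -
  let ?c = "taylor_coeff \<Theta>"
  let ?E = "2 * pi * (\<Sum>n. (cmod (?c n))\<^sup>2 * (1 - r j ^ n)\<^sup>2)"
  define u where "u = (\<lambda>k t. \<Theta> (of_real (r k) * cis t))"
  have H: "\<Theta> \<in> hardy2"
    using inner by (simp add: inner_function_def)
  note hol = hardy2_holomorphic[OF H]
  have u: "u k = circle_series (\<lambda>n. ?c n * of_real (r k) ^ n)"
    and sum_u: "summable (\<lambda>n. cmod (?c n * of_real (r k) ^ n))" for k
    using holomorphic_circle_series[OF hol r(1,2), of k] by (auto simp: u_def)
  have [measurable]: "u k \<in> borel_measurable circle_measure" for k
    unfolding u by measurable
  have "filterlim r (at_left 1) sequentially"
    using r(3) by (auto simp: filterlim_at less_imp_neq[OF r(2)] r(2))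
  then have lim: "AE t in circle_measure. \<exists>l. (\<lambda>k. u k t) \<longlonglongrightarrow> l \<and> cmod l = 1"
    using inner unfolding inner_function_def u_def
    by (auto elim!: eventually_mono intro: filterlim_compose)
  \<comment> \<open>Taking \<open>lim\<close> makes \<open>L\<close> total and measurable; off a
    null set it is the radial limit.\<close>
  define L where "L = (\<lambda>t. lim (\<lambda>k. u k t))"
  have [measurable]: "L \<in> borel_measurable circle_measure"
    unfolding L_def by measurable
  have L: "AE t in circle_measure. (\<lambda>k. u k t) \<longlonglongrightarrow> L t \<and> cmod (L t) = 1"
    using lim by eventually_elim (auto simp: L_def dest: limI)
  have sE: "summable (\<lambda>n. (cmod (?c n))\<^sup>2 * (1 - r j ^ n)\<^sup>2)"
    by (rule summable_comparison_test'[OF hardy2_summable[OF H]])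
       (intro one_minus_power_damping r)
  have E0: "0 \<le> ?E"
    by (intro mult_nonneg_nonneg suminf_nonneg sE) auto
  \<comment> \<open>The bound has to be independent of \<open>k\<close> to survive the limit. It is,
    since \<open>r j \<le> r k \<le> 1\<close> gives
    \<open>(r j ^ n - r k ^ n)\<^sup>2 \<le> (1 - r j ^ n)\<^sup>2\<close>.\<close>
  have le: "ennreal (LINT t|circle_measure. (cmod (u j t - u k t))\<^sup>2) \<le> ennreal ?E"
    and int_jk: "integrable circle_measure (\<lambda>t. (cmod (u j t - u k t))\<^sup>2)" if "j \<le> k" for k
  proof -
    let ?d = "\<lambda>n. ?c n * of_real (r j) ^ n - ?c n * of_real (r k) ^ n"
    have sd: "summable (\<lambda>n. cmod (?d n))"
      by (rule summable_comparison_test'[OF summable_add[OF sum_u[of j] sum_u[of k]]])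
         (simp add: norm_triangle_ineq4)
    have ud: "u j t - u k t = circle_series ?d t" for t
      unfolding u circle_series_def
      by (subst suminf_diff) (auto intro!: summable_circle_series(2) sum_u simp: left_diff_distrib)
    show "integrable circle_measure (\<lambda>t. (cmod (u j t - u k t))\<^sup>2)"
      unfolding ud by (rule circle_series_norm(1)[OF sd])
    have "(LINT t|circle_measure. (cmod (u j t - u k t))\<^sup>2) = (\<Sum>n. 2 * pi * (cmod (?d n))\<^sup>2)"
      using circle_series_norm(2)[OF sd] by (simp add: ud sums_iff)
    also have "\<dots> \<le> (\<Sum>n. 2 * pi * ((cmod (?c n))\<^sup>2 * (1 - r j ^ n)\<^sup>2))"
    proof (rule suminf_le)
      show "summable (\<lambda>n. 2 * pi * (cmod (?d n))\<^sup>2)"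
        using circle_series_norm(2)[OF sd] by (simp add: sums_iff)
      show "summable (\<lambda>n. 2 * pi * ((cmod (?c n))\<^sup>2 * (1 - r j ^ n)\<^sup>2))"
        by (intro summable_mult sE)
      fix n
      have "?d n = ?c n * of_real (r j ^ n - r k ^ n)"
        by (simp add: algebra_simps)
      then have "(cmod (?d n))\<^sup>2 = (cmod (?c n))\<^sup>2 * (r j ^ n - r k ^ n)\<^sup>2"
        by (simp only: norm_mult norm_of_real power_mult_distrib power2_abs)
      moreover have "(r j ^ n - r k ^ n)\<^sup>2 \<le> (1 - r j ^ n)\<^sup>2"
      proof -
        have "r j ^ n \<le> r k ^ n" "r k ^ n \<le> 1"
          using r(1)[of j] r(1)[of k] r(2)[of k] incseqD[OF r(4) that] by (auto intro!: power_mono power_le_one)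
        then have "(r k ^ n - r j ^ n)\<^sup>2 \<le> (1 - r j ^ n)\<^sup>2"
          by (intro power_mono) auto
        then show ?thesis
          by (simp add: power2_commute)
      qed
      ultimately show "2 * pi * (cmod (?d n))\<^sup>2 \<le> 2 * pi * ((cmod (?c n))\<^sup>2 * (1 - r j ^ n)\<^sup>2)"
        by (simp add: mult_left_mono)
    qed
    also have "\<dots> = ?E"
      by (rule suminf_mult[OF sE])
    finally show "ennreal (LINT t|circle_measure. (cmod (u j t - u k t))\<^sup>2) \<le> ennreal ?E"
      by (rule ennreal_leI)
  qed
  have "(\<integral>\<^sup>+t. ennreal ((cmod (u j t - L t))\<^sup>2) \<partial>circle_measure) =
      (\<integral>\<^sup>+t. liminf (\<lambda>k. ennreal ((cmod (u j t - u k t))\<^sup>2)) \<partial>circle_measure)"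
  proof (rule nn_integral_cong_AE, use L in eventually_elim)
    fix t assume "(\<lambda>k. u k t) \<longlonglongrightarrow> L t \<and> cmod (L t) = 1"
    then have "(\<lambda>k. ennreal ((cmod (u j t - u k t))\<^sup>2)) \<longlonglongrightarrow> ennreal ((cmod (u j t - L t))\<^sup>2)"
      by (auto intro!: tendsto_intros)
    then show "ennreal ((cmod (u j t - L t))\<^sup>2) = liminf (\<lambda>k. ennreal ((cmod (u j t - u k t))\<^sup>2))"
      by (intro lim_imp_Liminf[symmetric]) auto
  qed
  also have "\<dots> \<le> liminf (\<lambda>k. \<integral>\<^sup>+t. ennreal ((cmod (u j t - u k t))\<^sup>2) \<partial>circle_measure)"
    by (intro nn_integral_liminf) measurable
  also have "\<dots> \<le> limsup (\<lambda>k. \<integral>\<^sup>+t. ennreal ((cmod (u j t - u k t))\<^sup>2) \<partial>circle_measure)"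
    by (intro Liminf_le_Limsup) auto
  also have "\<dots> \<le> ennreal ?E"
  proof (rule Limsup_bounded)
    show "\<forall>\<^sub>F k in sequentially. (\<integral>\<^sup>+t. ennreal ((cmod (u j t - u k t))\<^sup>2) \<partial>circle_measure) \<le> ennreal ?E"
      using eventually_ge_at_top[of j]
    proof eventually_elim
      case (elim k)
      then show ?case
        using le[OF elim] by (subst nn_integral_eq_integral[OF int_jk]) auto
    qed
  qed
  finally have nn: "(\<integral>\<^sup>+t. ennreal ((cmod (u j t - L t))\<^sup>2) \<partial>circle_measure) \<le> ennreal ?E" .
  have intL: "integrable circle_measure (\<lambda>t. (cmod (u j t - L t))\<^sup>2)"
    by (rule integrableI_bounded) (use nn in \<open>auto simp: le_less_trans\<close>)
  have "ennreal (LINT t|circle_measure. (cmod (u j t - L t))\<^sup>2) \<le> ennreal ?E"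
    using nn by (subst (asm) nn_integral_eq_integral[OF intL]) auto
  with E0 have leE: "(LINT t|circle_measure. (cmod (u j t - L t))\<^sup>2) \<le> ?E"
    by simp
  have "(LINT t|circle_measure. \<bar>(cmod (u j t))\<^sup>2 - 1\<bar>) \<le>
      (LINT t|circle_measure. (1 + 1 / \<epsilon>) * (cmod (u j t - L t))\<^sup>2 + \<epsilon>)"
  proof (rule integral_mono_AE)
    show "integrable circle_measure (\<lambda>t. \<bar>(cmod (u j t))\<^sup>2 - 1\<bar>)"
      unfolding u by (intro integrable_abs Bochner_Integration.integrable_diff circle_series_norm(1) sum_u[unfolded u]) (use sum_u in auto)
    show "integrable circle_measure (\<lambda>t. (1 + 1 / \<epsilon>) * (cmod (u j t - L t))\<^sup>2 + \<epsilon>)"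
      by (intro Bochner_Integration.integrable_add integrable_mult_right intL) auto
    show "AE t in circle_measure. \<bar>(cmod (u j t))\<^sup>2 - 1\<bar> \<le> (1 + 1 / \<epsilon>) * (cmod (u j t - L t))\<^sup>2 + \<epsilon>"
      using L by eventually_elim (rule abs_norm_sq_diff_1_le, use \<epsilon> in auto)
  qed
  also have "\<dots> = (1 + 1 / \<epsilon>) * (LINT t|circle_measure. (cmod (u j t - L t))\<^sup>2) + 2 * pi * \<epsilon>"
    by (subst Bochner_Integration.integral_add)
       (auto simp: integral_circle_const_of_real[simplified] intro: integrable_mult_right intL)
  also have "\<dots> \<le> (1 + 1 / \<epsilon>) * ?E + 2 * pi * \<epsilon>"
    using \<epsilon> by (intro add_right_mono mult_left_mono leE) auto
  finally show ?thesis
    by (simp add: u_def)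
qed

text \<open>The \<open>m\<close>-th Fourier coefficient \<open>A j\<close> of the squared modulus on
  the circle of radius \<open>r j\<close> is followed to the boundary in two ways. Parseval leads to
  the inner product of \<open>\<Theta>\<close> with \<open>z ^ m * \<Theta> z\<close>, and the
  boundary estimate leads to the Fourier coefficient of the constant one.\<close>

lemma inner_function_algebraic:
  assumes inner: "inner_function \<Theta>"
  shows "algebraic_inner \<Theta>"
proof -
  let ?c = "taylor_coeff \<Theta>"
  define r where "r = (\<lambda>k. 1 - 1 / (real k + 1))"
  have r: "\<And>k. 0 \<le> r k" "\<And>k. r k < 1" "incseq r"
    by (auto simp: r_def incseq_def frac_le)
  have rlim: "r \<longlonglongrightarrow> 1"
    unfolding r_def by real_asymp
  have H: "\<Theta> \<in> hardy2"
    using inner by (simp add: inner_function_def)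
  note hol = hardy2_holomorphic[OF H]
  define E where "E = (\<lambda>j. 2 * pi * (\<Sum>n. (cmod (?c n))\<^sup>2 * (1 - r j ^ n)\<^sup>2))"
  \<comment> \<open>Tannery's theorem: each term tends to \<open>0\<close> and is dominated by the
    squared coefficient, so the error \<open>E j\<close> in the boundary estimate vanishes in the
    limit.\<close>
  have "(\<lambda>j. \<Sum>n. (cmod (?c n))\<^sup>2 * (1 - r j ^ n)\<^sup>2) \<longlonglongrightarrow> (\<Sum>n. 0)"
  proof (intro tannerys_theorem[THEN conjunct2, THEN conjunct2])
    show "(\<lambda>j. (cmod (?c n))\<^sup>2 * (1 - r j ^ n)\<^sup>2) \<longlonglongrightarrow> 0" for n
      by (rule tendsto_eq_intros rlim refl | simp)+
    have "norm ((cmod (?c n))\<^sup>2 * (1 - r j ^ n)\<^sup>2) \<le> (cmod (?c n))\<^sup>2" for n j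
      by (intro one_minus_power_damping r)
    then show "\<forall>\<^sub>F (n, j) in at_top \<times>\<^sub>F sequentially.
        norm ((cmod (?c n))\<^sup>2 * (1 - r j ^ n)\<^sup>2) \<le> (cmod (?c n))\<^sup>2"
      by (intro always_eventually) auto
  qed (use hardy2_summable[OF H] in auto)
  then have E: "E \<longlonglongrightarrow> 0"
    unfolding E_def by (auto intro: tendsto_eq_intros)
  have "hardy2_inner \<Theta> (\<lambda>z. z ^ m * \<Theta> z) = (if m = 0 then 1 else 0)" for m
  proof -
    let ?d = "taylor_coeff (\<lambda>z. z ^ m * \<Theta> z)" and ?\<delta> = "if m = 0 then 2 * pi else (0 :: complex)"
    have H': "(\<lambda>z. z ^ m * \<Theta> z) \<in> hardy2"
      by (rule hardy2_shift[OF H])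
    note hol' = hardy2_holomorphic[OF H']
    define u where "u = (\<lambda>j t. \<Theta> (of_real (r j) * cis t))"
    define A where "A = (\<lambda>j. LINT t|circle_measure. of_real ((cmod (u j t))\<^sup>2) * cnj (cis t ^ m))"
    \<comment> \<open>The factor \<open>of_real (r j) ^ m\<close> appears because
      \<open>z ^ m * \<Theta> z\<close> is evaluated at \<open>r j * cis t\<close>, whereas
      \<open>A\<close> carries only the power of \<open>cis t\<close>. It tends to
      \<open>1\<close>.\<close>
    have A_eq: "of_real (r j) ^ m * A j = (\<Sum>n. 2 * pi * (?c n * cnj (?d n)) * of_real (r j) ^ (2 * n))" for j
    proof -
      have sums: "(\<lambda>n. 2 * pi * (?c n * of_real (r j) ^ n * cnj (?d n * of_real (r j) ^ n))) sums
          (LINT t|circle_measure. u j t * cnj ((of_real (r j) * cis t) ^ m * u j t))"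
        using circle_series_Parseval[OF holomorphic_circle_series(1)[OF hol r(1,2)]
            holomorphic_circle_series(1)[OF hol' r(1,2)], of j j]
        unfolding holomorphic_circle_series(2)[OF hol r(1,2), symmetric]
          holomorphic_circle_series(2)[OF hol' r(1,2), symmetric] u_def .
      have "u j t * cnj ((of_real (r j) * cis t) ^ m * u j t) =
          of_real (r j) ^ m * (of_real ((cmod (u j t))\<^sup>2) * cnj (cis t ^ m))" for t
        unfolding complex_norm_square by (simp add: power_mult_distrib mult_ac)
      then have int: "(LINT t|circle_measure. u j t * cnj ((of_real (r j) * cis t) ^ m * u j t)) =
          of_real (r j) ^ m * A j"
        unfolding A_def by (simp only: integral_mult_right_zero)
      have summand: "2 * pi * (?c n * of_real (r j) ^ n * cnj (?d n * of_real (r j) ^ n)) =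
          2 * pi * (?c n * cnj (?d n)) * of_real (r j) ^ (2 * n)" for n
        unfolding mult_2 power_add
        by (simp only: complex_cnj_mult complex_cnj_power complex_cnj_complex_of_real mult_ac)
      show ?thesis
        using sums_unique[OF sums] unfolding int summand .
    qed
    have "(\<lambda>j. \<Sum>n. 2 * pi * (?c n * cnj (?d n)) * of_real (r j) ^ (2 * n)) \<longlonglongrightarrow>
        (\<Sum>n. 2 * pi * (?c n * cnj (?d n)))"
    proof (intro tannerys_theorem[THEN conjunct2, THEN conjunct2])
      show "(\<lambda>j. 2 * pi * (?c n * cnj (?d n)) * of_real (r j) ^ (2 * n)) \<longlonglongrightarrow>
          2 * pi * (?c n * cnj (?d n))" for n
        by (rule tendsto_eq_intros rlim refl | simp)+
      have "norm (2 * pi * (?c n * cnj (?d n)) * of_real (r j) ^ (2 * n)) \<le>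
          2 * pi * cmod (?c n * cnj (?d n))" for n j
        using r(1)[of j] r(2)[of j]
        by (simp add: norm_mult norm_power mult_right_le_one_le power_le_one)
      then show "\<forall>\<^sub>F (n, j) in at_top \<times>\<^sub>F sequentially.
          norm (2 * pi * (?c n * cnj (?d n)) * of_real (r j) ^ (2 * n)) \<le>
          2 * pi * cmod (?c n * cnj (?d n))"
        by (intro always_eventually) auto
      show "summable (\<lambda>n. 2 * pi * cmod (?c n * cnj (?d n)))"
        by (intro summable_mult hardy2_Cauchy_Schwarz(1) H H')
    qed auto
    moreover have "(\<Sum>n. 2 * pi * (?c n * cnj (?d n))) = 2 * pi * hardy2_inner \<Theta> (\<lambda>z. z ^ m * \<Theta> z)"
      unfolding hardy2_inner_def
      by (intro suminf_mult sums_summable[OF hardy2_inner_sums] H H')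
    ultimately have lim1: "(\<lambda>j. of_real (r j) ^ m * A j) \<longlonglongrightarrow>
        2 * pi * hardy2_inner \<Theta> (\<lambda>z. z ^ m * \<Theta> z)"
      unfolding A_eq by simp
    have diff: "cmod (A j - ?\<delta>) \<le> (1 + 1 / \<epsilon>) * E j + 2 * pi * \<epsilon>" if "0 < \<epsilon>" for j \<epsilon>
    proof -
      note sj = holomorphic_circle_series(1)[OF hol r(1,2), of j]
      have uj: "u j = circle_series (\<lambda>n. ?c n * of_real (r j) ^ n)"
        using holomorphic_circle_series(2)[OF hol r(1,2)] by (auto simp: u_def)
      have [measurable]: "u j \<in> borel_measurable circle_measure"
        unfolding uj by measurable
      have i0: "integrable circle_measure (\<lambda>t. (cmod (u j t))\<^sup>2)"
        unfolding uj by (rule circle_series_norm(1)[OF sj])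
      have i1: "integrable circle_measure (\<lambda>t. of_real ((cmod (u j t))\<^sup>2) * cnj (cis t ^ m))"
        by (rule Bochner_Integration.integrable_bound[OF i0]) (measurable, simp add: norm_mult norm_power)
      have i2: "integrable circle_measure (\<lambda>t. cnj (cis t ^ m))"
        by (rule integrable_circle_bounded[of _ 1]) (measurable, simp add: norm_power)
      have "?\<delta> = (LINT t|circle_measure. cnj (cis t ^ m))"
        using integral_circle_characters[of 0 m] by (auto split: if_splits)
      then have "A j - ?\<delta> = (LINT t|circle_measure.
          of_real ((cmod (u j t))\<^sup>2) * cnj (cis t ^ m) - cnj (cis t ^ m))"
        unfolding A_def by (subst Bochner_Integration.integral_diff[OF i1 i2]) simp
      also have "cmod \<dots> \<le> (LINT t|circle_measure.
          cmod (of_real ((cmod (u j t))\<^sup>2) * cnj (cis t ^ m) - cnj (cis t ^ m)))"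
        by (rule integral_norm_bound)
      also have "\<dots> = (LINT t|circle_measure. \<bar>(cmod (u j t))\<^sup>2 - 1\<bar>)"
      proof (rule Bochner_Integration.integral_cong[OF refl])
        fix t
        have "of_real ((cmod (u j t))\<^sup>2) * cnj (cis t ^ m) - cnj (cis t ^ m) =
            of_real ((cmod (u j t))\<^sup>2 - 1) * cnj (cis t ^ m)"
          by (simp add: algebra_simps)
        then show "cmod (of_real ((cmod (u j t))\<^sup>2) * cnj (cis t ^ m) - cnj (cis t ^ m)) =
            \<bar>(cmod (u j t))\<^sup>2 - 1\<bar>"
          by (simp only: norm_mult norm_of_real) (simp add: norm_power)
      qed
      also have "\<dots> \<le> (1 + 1 / \<epsilon>) * E j + 2 * pi * \<epsilon>"
        using inner_function_boundary_estimate[OF inner r(1,2) rlim r(3) that, of j]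
        by (simp add: u_def E_def)
      finally show ?thesis .
    qed
    have "A \<longlonglongrightarrow> ?\<delta>"
    proof (rule tendstoI)
      fix e :: real assume "0 < e"
      \<comment> \<open>This makes \<open>2 * pi * \<epsilon>\<close> half of \<open>e\<close>; the
        other half absorbs the term with \<open>E j\<close>, whose factor
        \<open>1 + 1 / \<epsilon>\<close> is now fixed.\<close>
      define \<epsilon> where "\<epsilon> = e / (4 * pi)"
      have \<epsilon>: "0 < \<epsilon>" "2 * pi * \<epsilon> = e / 2"
        using \<open>0 < e\<close> by (auto simp: \<epsilon>_def)
      have "(\<lambda>j. (1 + 1 / \<epsilon>) * E j + 2 * pi * \<epsilon>) \<longlonglongrightarrow> (1 + 1 / \<epsilon>) * 0 + 2 * pi * \<epsilon>"
        by (intro tendsto_intros E)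
      then have "\<forall>\<^sub>F j in sequentially. (1 + 1 / \<epsilon>) * E j + 2 * pi * \<epsilon> < e"
        by (rule order_tendstoD) (use \<epsilon> \<open>0 < e\<close> in simp)
      then show "\<forall>\<^sub>F j in sequentially. dist (A j) ?\<delta> < e"
        by eventually_elim (use diff[OF \<epsilon>(1)] in \<open>auto simp only: dist_norm intro: le_less_trans\<close>)
    qed
    then have "(\<lambda>j. of_real (r j) ^ m * A j) \<longlonglongrightarrow> of_real 1 ^ m * ?\<delta>"
      by (intro tendsto_intros rlim)
    with lim1 have "2 * pi * hardy2_inner \<Theta> (\<lambda>z. z ^ m * \<Theta> z) = of_real 1 ^ m * ?\<delta>"
      by (rule LIMSEQ_unique)
    then show ?thesis
      by (auto split: if_splits)
  qed
  with H show ?thesis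
    by (simp add: algebraic_inner_def)
qed

text \<open>A common power of \<open>z\<close> cancels from the inner product, which leaves the
  defining condition for the difference of the exponents; conjugate symmetry covers
  \<open>n < m\<close>.\<close>

lemma algebraic_innerD:
  assumes "algebraic_inner F"
  shows "F \<in> hardy2"
    and "hardy2_inner (\<lambda>z. z ^ m * F z) (\<lambda>z. z ^ n * F z) = (if m = n then 1 else 0)"
proof -
  show F: "F \<in> hardy2"
    using assms by (simp add: algebraic_inner_def)
  have *: "hardy2_inner (\<lambda>z. z ^ m * F z) (\<lambda>z. z ^ (m + k) * F z) = (if k = 0 then 1 else 0)" for m k
    using hardy2_inner_shift[OF F hardy2_shift[OF F, of k], of m] assms
    by (simp add: power_add mult.assoc algebraic_inner_def)
  show "hardy2_inner (\<lambda>z. z ^ m * F z) (\<lambda>z. z ^ n * F z) = (if m = n then 1 else 0)"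
  proof (cases "m \<le> n")
    case True
    then show ?thesis
      using *[of m "n - m"] by auto
  next
    case False
    then show ?thesis
      using *[of n "m - n"] hardy2_inner_commute[OF hardy2_shift[OF F, of m] hardy2_shift[OF F, of n]]
      by auto
  qed
qed

lemma algebraic_inner_self: "algebraic_inner F \<Longrightarrow> hardy2_inner F F = 1"
  using algebraic_innerD(2)[of F 0 0] by simp

text \<open>Testing \<open>F\<close> against the partial sums of the reproducing kernel at \<open>w\<close>, on which
  multiplication by \<open>F\<close> is isometric.\<close>

lemma algebraic_inner_bounded:
  assumes F: "algebraic_inner F" and w: "w \<in> ball 0 1"
  shows "cmod (F w) \<le> 1"
proof -
  note H = algebraic_innerD(1)[OF F]
  define k where "k = (\<lambda>N z. \<Sum>n<N. cnj w ^ n * (z ^ n * F z))"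
  define S where "S = (\<lambda>N. \<Sum>n<N. (cmod w ^ n)\<^sup>2)"
  have sq: "complex_of_real ((cmod w ^ n)\<^sup>2) = w ^ n * cnj w ^ n" for n
    using complex_norm_square[of "w ^ n"] by (simp add: norm_power)
  have k: "k N \<in> hardy2" for N
    unfolding k_def by (intro hardy2_sum hardy2_cmult hardy2_shift H) auto
  have kn: "(hardy2_norm (k N))\<^sup>2 = S N" for N
  proof -
    have "hardy2_inner (k N) (k N) = (\<Sum>n<N. cnj w ^ n * hardy2_inner (\<lambda>z. z ^ n * F z) (k N))"
      unfolding k_def
      by (simp only: hardy2_inner_sum_left hardy2_inner_cmult_left hardy2_cmult hardy2_shift
          hardy2_sum H finite_lessThan k[unfolded k_def])
    also have "\<dots> = (\<Sum>n<N. cnj w ^ n * (\<Sum>m<N. w ^ m * (if n = m then 1 else 0)))"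
      unfolding k_def
      by (simp only: hardy2_inner_sum_right hardy2_inner_cmult_right hardy2_cmult hardy2_shift
          H finite_lessThan algebraic_innerD(2)[OF F] complex_cnj_power complex_cnj_cnj)
    also have "\<dots> = of_real (S N)"
      unfolding S_def of_real_sum sq by (simp add: if_distrib mult.commute cong: if_cong)
    finally show ?thesis
      unfolding hardy2_inner_self[OF k] of_real_eq_iff .
  qed
  have kw: "k N w = of_real (S N) * F w" for N
    unfolding k_def S_def of_real_sum sum_distrib_right
    by (intro sum.cong refl) (simp only: sq mult_ac)
  have Slim: "S \<longlonglongrightarrow> 1 / (1 - (cmod w)\<^sup>2)"
  proof -
    have "(cmod w)\<^sup>2 < 1"
      using w by (simp add: power_less_one_iff)
    then have "(\<lambda>n. ((cmod w)\<^sup>2) ^ n) sums (1 / (1 - (cmod w)\<^sup>2))"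
      by (intro geometric_sums) simp
    then show ?thesis
      by (simp add: sums_def S_def power_mult[symmetric] mult.commute)
  qed
  let ?K = "(hardy2_norm (szego w))\<^sup>2"
  \<comment> \<open>Point evaluation at \<open>w\<close> is applied to \<open>k N\<close>, whose
    value there is \<open>S N * F w\<close> and whose squared norm is \<open>S N\<close>. Since
    \<open>S N\<close> tends to \<open>?K\<close>, the limit is an inequality from which
    \<open>?K\<close> cancels.\<close>
  have "(S N * cmod (F w))\<^sup>2 \<le> S N * ?K" for N
  proof -
    have "S N * cmod (F w) = cmod (k N w)"
      unfolding kw norm_mult norm_of_real by (simp add: S_def sum_nonneg)
    also have "\<dots> \<le> hardy2_norm (k N) * hardy2_norm (szego w)"
      by (rule hardy2_pointwise_bound[OF k w])
    finally have "(S N * cmod (F w))\<^sup>2 \<le> (hardy2_norm (k N) * hardy2_norm (szego w))\<^sup>2"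
      by (rule power_mono) (simp add: S_def sum_nonneg)
    then show ?thesis
      by (simp add: power_mult_distrib kn)
  qed
  moreover have "(\<lambda>N. (S N * cmod (F w))\<^sup>2) \<longlonglongrightarrow> (?K * cmod (F w))\<^sup>2"
    "(\<lambda>N. S N * ?K) \<longlonglongrightarrow> ?K * ?K"
    using Slim unfolding hardy2_szego(2)[OF w] by (intro tendsto_intros; simp)+
  ultimately have "(?K * cmod (F w))\<^sup>2 \<le> ?K * ?K"
    by (intro LIMSEQ_le) auto
  then have "(?K * cmod (F w))\<^sup>2 \<le> (?K * 1)\<^sup>2"
    by (simp add: power2_eq_square)
  then have "?K * cmod (F w) \<le> ?K * 1"
    by (rule power2_le_imp_le) simp
  then show ?thesis
    using hardy2_norm_szego_pos[OF w] by simp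
qed

section \<open>Multiplication by an inner function as an isometry\<close>

lemma
  assumes F: "algebraic_inner F" and h: "h \<in> hardy2"
  shows hardy2_inner_mult: "(\<lambda>z. F z * h z) \<in> hardy2"
    and hardy2_norm_inner_mult_le: "hardy2_norm (\<lambda>z. F z * h z) \<le> hardy2_norm h"
  using hardy2_bounded_mult[OF hardy2_holomorphic[OF algebraic_innerD(1)[OF F]] algebraic_inner_bounded[OF F] h]
    hardy2_norm_bounded_mult[OF hardy2_holomorphic[OF algebraic_innerD(1)[OF F]] algebraic_inner_bounded[OF F] h]
  by auto

text \<open>Continuity of multiplication by \<open>F\<close>: the function \<open>R N\<close> is
  minus the Taylor tail of \<open>h\<close>, its norm tends to \<open>0\<close>, and multiplying by
  \<open>F\<close> does not increase it. This carries identities from polynomials to all of the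
  Hardy space.\<close>

lemma hardy2_inner_mult_sums:
  assumes F: "algebraic_inner F" and h: "h \<in> hardy2" and g: "g \<in> hardy2"
  shows "(\<lambda>n. taylor_coeff h n * hardy2_inner (\<lambda>z. z ^ n * F z) g) sums
    hardy2_inner (\<lambda>z. F z * h z) g"
  unfolding sums_def
proof (rule LIM_zero_cancel)
  note H = algebraic_innerD(1)[OF F]
  let ?c = "taylor_coeff h"
  define p where "p = (\<lambda>N z. \<Sum>n<N. ?c n * z ^ n)"
  define R where "R = (\<lambda>N z. (-1) * h z + p N z)"
  have p: "p N \<in> hardy2" for N
    unfolding p_def by (intro hardy2_sum hardy2_cmult hardy2_power) auto
  have R: "R N \<in> hardy2" for N
    unfolding R_def by (intro hardy2_add hardy2_cmult h p)
  have tc: "cmod (taylor_coeff (R N) n) = (if n < N then 0 else cmod (?c n))" for N n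
  proof -
    have "taylor_coeff (p N) n = (\<Sum>i<N. ?c i * (if n = i then 1 else 0))"
      unfolding p_def
      by (subst taylor_coeff_sum) (auto simp: taylor_coeff_cmult[OF hardy2_holomorphic[OF hardy2_power]] taylor_coeff_power
          intro!: holomorphic_intros)
    also have "\<dots> = (if n < N then ?c n else 0)"
      by (simp add: if_distrib cong: if_cong)
    finally have "taylor_coeff (p N) n = (if n < N then ?c n else 0)" .
    moreover have "taylor_coeff (R N) n = (-1) * ?c n + taylor_coeff (p N) n"
      by (simp only: R_def taylor_coeff_cmult[OF hardy2_holomorphic[OF h]]
          taylor_coeff_add[OF hardy2_holomorphic[OF hardy2_cmult[OF h]] hardy2_holomorphic[OF p]])
    ultimately show ?thesis
      by simp
  qed
  have Rn: "(hardy2_norm (R N))\<^sup>2 = (hardy2_norm h)\<^sup>2 - (\<Sum>n<N. (cmod (?c n))\<^sup>2)" for N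
  proof -
    have "(\<lambda>n. if n < N then (cmod (?c n))\<^sup>2 else 0) sums (\<Sum>n<N. (cmod (?c n))\<^sup>2)"
      using sums_If_finite_set[of "{..<N}" "\<lambda>n. (cmod (?c n))\<^sup>2"] by simp
    moreover have "(\<lambda>n. (cmod (?c n))\<^sup>2) sums (hardy2_norm h)\<^sup>2"
      unfolding hardy2_norm_sq[OF h] by (rule summable_sums[OF hardy2_summable[OF h]])
    ultimately have "(\<lambda>n. (cmod (?c n))\<^sup>2 - (if n < N then (cmod (?c n))\<^sup>2 else 0)) sums
        ((hardy2_norm h)\<^sup>2 - (\<Sum>n<N. (cmod (?c n))\<^sup>2))"
      by (intro sums_diff)
    moreover have "(\<lambda>n. (cmod (?c n))\<^sup>2 - (if n < N then (cmod (?c n))\<^sup>2 else 0)) =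
        (\<lambda>n. (cmod (taylor_coeff (R N) n))\<^sup>2)"
      by (auto simp: tc)
    ultimately show ?thesis
      by (simp add: hardy2_norm_sq[OF R] sums_iff)
  qed
  have "(\<lambda>N. (hardy2_norm (R N))\<^sup>2) \<longlonglongrightarrow> (hardy2_norm h)\<^sup>2 - (hardy2_norm h)\<^sup>2"
    unfolding Rn hardy2_norm_sq[OF h]
    by (intro tendsto_intros summable_LIMSEQ hardy2_summable h)
  then have "(\<lambda>N. sqrt ((hardy2_norm (R N))\<^sup>2) * hardy2_norm g) \<longlonglongrightarrow> sqrt 0 * hardy2_norm g"
    by (intro tendsto_intros) simp
  then have lim: "(\<lambda>N. hardy2_norm (R N) * hardy2_norm g) \<longlonglongrightarrow> 0"
    by (simp add: hardy2_norm_nonneg[OF R])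
  show "(\<lambda>N. (\<Sum>n<N. ?c n * hardy2_inner (\<lambda>z. z ^ n * F z) g) -
      hardy2_inner (\<lambda>z. F z * h z) g) \<longlonglongrightarrow> 0"
  proof (rule Lim_null_comparison[OF always_eventually lim], rule allI)
    fix N
    have "(\<lambda>z. F z * R N z) = (\<lambda>z. (-1) * (F z * h z) + (\<Sum>n<N. ?c n * (z ^ n * F z)))"
      by (simp add: R_def p_def algebra_simps sum_distrib_left fun_eq_iff)
    then have "hardy2_inner (\<lambda>z. F z * R N z) g =
        (-1) * hardy2_inner (\<lambda>z. F z * h z) g + (\<Sum>n<N. ?c n * hardy2_inner (\<lambda>z. z ^ n * F z) g)"
      by (simp only: hardy2_inner_add_left hardy2_inner_sum_left hardy2_inner_cmult_left g h H
          hardy2_cmult hardy2_sum hardy2_shift hardy2_inner_mult[OF F] finite_lessThan)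
    then have "(\<Sum>n<N. ?c n * hardy2_inner (\<lambda>z. z ^ n * F z) g) - hardy2_inner (\<lambda>z. F z * h z) g =
        hardy2_inner (\<lambda>z. F z * R N z) g"
      by simp
    also have "cmod \<dots> \<le> hardy2_norm (\<lambda>z. F z * R N z) * hardy2_norm g"
      by (intro hardy2_Cauchy_Schwarz hardy2_inner_mult F R g)
    also have "\<dots> \<le> hardy2_norm (R N) * hardy2_norm g"
      by (intro mult_right_mono hardy2_norm_inner_mult_le F R hardy2_norm_nonneg g)
    finally show "cmod ((\<Sum>n<N. ?c n * hardy2_inner (\<lambda>z. z ^ n * F z) g) -
        hardy2_inner (\<lambda>z. F z * h z) g) \<le> hardy2_norm (R N) * hardy2_norm g" .
  qed
qed

text \<open>Orthonormality of the functions \<open>z ^ n * F z\<close> settles the case of a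
  monomial in the second argument; conjugate symmetry moves the monomial to the first argument,
  where \<open>h\<close> is then expanded.\<close>

lemma algebraic_inner_isometry:
  assumes F: "algebraic_inner F" and h: "h \<in> hardy2" and k: "k \<in> hardy2"
  shows "hardy2_inner (\<lambda>z. F z * h z) (\<lambda>z. F z * k z) = hardy2_inner h k"
proof -
  note H = algebraic_innerD(1)[OF F]
  have single: "hardy2_inner (\<lambda>z. F z * h z) (\<lambda>z. z ^ m * F z) = taylor_coeff h m" if h: "h \<in> hardy2" for h m
  proof -
    have "(\<lambda>n. taylor_coeff h n * (if n = m then 1 else 0)) sums
        hardy2_inner (\<lambda>z. F z * h z) (\<lambda>z. z ^ m * F z)"
      using hardy2_inner_mult_sums[OF F h hardy2_shift[OF H, of m]]
      unfolding algebraic_innerD(2)[OF F] .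
    moreover have "(\<lambda>n. taylor_coeff h n * (if n = m then 1 else 0)) sums taylor_coeff h m"
      using sums_single[of m "taylor_coeff h"] by (simp add: if_distrib cong: if_cong)
    ultimately show ?thesis
      by (rule sums_unique2)
  qed
  have "hardy2_inner (\<lambda>z. z ^ n * F z) (\<lambda>z. F z * k z) = cnj (taylor_coeff k n)" for n
    using hardy2_inner_commute[OF hardy2_shift[OF H, of n] hardy2_inner_mult[OF F k]] single[OF k, of n]
    by simp
  then have "(\<lambda>n. taylor_coeff h n * cnj (taylor_coeff k n)) sums
      hardy2_inner (\<lambda>z. F z * h z) (\<lambda>z. F z * k z)"
    using hardy2_inner_mult_sums[OF F h hardy2_inner_mult[OF F k]] by simp
  then show ?thesis
    using hardy2_inner_sums[OF h k] sums_unique2 by blast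
qed

lemma algebraic_inner_norm:
  assumes F: "algebraic_inner F" and h: "h \<in> hardy2"
  shows "hardy2_norm (\<lambda>z. F z * h z) = hardy2_norm h"
proof -
  have "(hardy2_norm (\<lambda>z. F z * h z))\<^sup>2 = (hardy2_norm h)\<^sup>2"
    using algebraic_inner_isometry[OF F h h]
    unfolding hardy2_inner_self[OF h] hardy2_inner_self[OF hardy2_inner_mult[OF F h]] of_real_eq_iff .
  then show ?thesis
    using hardy2_norm_nonneg[OF h] hardy2_norm_nonneg[OF hardy2_inner_mult[OF F h]]
    by (simp add: power2_eq_iff_nonneg)
qed

section \<open>Invariant model spaces\<close>

lemma model_space_iff:
  "f \<in> model_space F \<longleftrightarrow> f \<in> hardy2 \<and> (\<forall>h\<in>hardy2. hardy2_inner f (\<lambda>z. F z * h z) = 0)"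
  by (auto simp: model_space_def hardy2_orth_def)

text \<open>Against \<open>F z * h z\<close> the first summand pairs to
  \<open>cnj (F w * h w)\<close> by the reproducing property, and \<open>F z * szego w z\<close>
  pairs to \<open>cnj (h w)\<close> by the isometry. The factor \<open>- cnj (F w)\<close> makes the
  two cancel.\<close>

lemma model_space_kernel:
  assumes F: "algebraic_inner F" and w: "w \<in> ball 0 1"
  shows "(\<lambda>z. szego w z + (- cnj (F w)) * (F z * szego w z)) \<in> model_space F"
proof -
  note K = hardy2_szego(1)[OF w]
  note FK = hardy2_inner_mult[OF F K]
  have "hardy2_inner (\<lambda>z. szego w z + (- cnj (F w)) * (F z * szego w z)) (\<lambda>z. F z * h z) = 0"
    if h: "h \<in> hardy2" for h
  proof -
    note Fh = hardy2_inner_mult[OF F h]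
    have "hardy2_inner (szego w) (\<lambda>z. F z * h z) = cnj (F w * h w)"
      using hardy2_inner_commute[OF K Fh] hardy2_inner_szego[OF Fh w] by simp
    moreover have "hardy2_inner (\<lambda>z. F z * szego w z) (\<lambda>z. F z * h z) = cnj (h w)"
      using algebraic_inner_isometry[OF F K h] hardy2_inner_commute[OF K h] hardy2_inner_szego[OF h w]
      by simp
    ultimately show ?thesis
      by (simp only: hardy2_inner_add_left[OF K hardy2_cmult[OF FK] Fh]
          hardy2_inner_cmult_left[OF FK Fh]) simp
  qed
  then show ?thesis
    unfolding model_space_iff by (intro conjI ballI hardy2_add hardy2_cmult K FK)
qed

text \<open>In the coordinate \<open>1 / w - 1\<close> this map is division by \<open>a\<close>.
  Hence it fixes \<open>0\<close> and \<open>1\<close>, and the map for \<open>a ^ k\<close> is the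
  \<open>k\<close>-th iterate of the map for \<open>a\<close>.\<close>

definition adjoint_symbol :: "real \<Rightarrow> complex \<Rightarrow> complex" where
  "adjoint_symbol a w = of_real a * w / (1 - (1 - of_real a) * w)"

lemma
  assumes a: "0 < a" "a \<le> 1" and w: "w \<in> ball 0 1"
  shows adjoint_symbol_denominator: "1 - (1 - of_real a) * w \<noteq> 0"
    and adjoint_symbol_in_ball: "adjoint_symbol a w \<in> ball 0 1"
proof -
  have "cmod ((1 - of_real a) * w) = (1 - a) * cmod w"
    using a norm_of_real[of "1 - a", where 'a = complex] by (simp add: norm_mult)
  moreover have "a * cmod w < 1 - (1 - a) * cmod w"
    using w by (simp add: algebra_simps)
  moreover have "cmod (of_real a * w) = a * cmod w"
    using a by (simp add: norm_mult)
  ultimately have *: "cmod (of_real a * w) < cmod (1 - (1 - of_real a) * w)"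
    using norm_triangle_ineq2[of 1 "(1 - of_real a) * w"] unfolding norm_one by linarith
  then show "1 - (1 - of_real a) * w \<noteq> 0"
    by (metis norm_ge_zero norm_zero not_less)
  with * show "adjoint_symbol a w \<in> ball 0 1"
    by (simp add: adjoint_symbol_def norm_divide)
qed

lemma affine_symbol_in_ball:
  assumes a: "0 < a" "a \<le> 1" and z: "z \<in> ball 0 1"
  shows "affine_symbol a z \<in> ball 0 1"
proof -
  have "cmod (affine_symbol a z) = cmod (of_real a * z + of_real (1 - a))"
    by (simp add: affine_symbol_def algebra_simps)
  also have "\<dots> \<le> a * cmod z + (1 - a)"
    using norm_triangle_ineq[of "of_real a * z" "of_real (1 - a)"] a
    by (simp add: norm_mult del: of_real_diff)
  also have "\<dots> < 1"
    using a z by simp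
  finally show ?thesis
    by simp
qed

text \<open>The denominator of the kernel stays affine in \<open>z\<close>. Dividing it by its
  constant term \<open>1 - (1 - a) * cnj w\<close> restores the shape of a kernel and dictates the
  formula for \<open>adjoint_symbol\<close>.\<close>

lemma szego_affine_symbol:
  assumes a: "0 < a" "a \<le> 1" and w: "w \<in> ball 0 1" and z: "z \<in> ball 0 1"
  shows "szego w (affine_symbol a z) =
    inverse (1 - (1 - of_real a) * cnj w) * szego (adjoint_symbol a w) z"
proof -
  let ?D = "1 - (1 - of_real a) * cnj w"
  have D: "?D \<noteq> 0"
    using adjoint_symbol_denominator[OF a, of "cnj w"] w by simp
  have "1 - cnj w * affine_symbol a z = ?D * (1 - cnj (adjoint_symbol a w) * z)"
    using D by (simp add: adjoint_symbol_def affine_symbol_def field_simps)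
  then show ?thesis
    by (simp add: szego_def divide_simps)
qed

text \<open>The model space contains the projection of the reproducing kernel at \<open>w\<close>. Composing it with
  the affine symbol and pairing with \<open>F\<close> times the reproducing kernel at \<open>adjoint_symbol a w\<close>
  exhibits \<open>F (adjoint_symbol a w)\<close> as a multiple of \<open>F w\<close> by a factor of modulus at most one.\<close>

lemma invariant_model_space_norm_le:
  assumes F: "algebraic_inner F" and a: "0 < a" "a \<le> 1" and w: "w \<in> ball 0 1"
    and inv: "\<And>f. f \<in> model_space F \<Longrightarrow> f \<circ> affine_symbol a \<in> model_space F"
  shows "cmod (F (adjoint_symbol a w)) \<le> cmod (F w)"
proof -
  define s where "s = adjoint_symbol a w"
  have s: "s \<in> ball 0 1"
    unfolding s_def by (rule adjoint_symbol_in_ball[OF a w])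
  note K = hardy2_szego(1)[OF s]
  note FK = hardy2_inner_mult[OF F K]
  define D where "D = inverse (1 - (1 - of_real a) * cnj w)"
  have D: "D \<noteq> 0"
    using adjoint_symbol_denominator[OF a, of "cnj w"] w by (simp add: D_def)
  let ?k = "\<lambda>z. szego w z + (- cnj (F w)) * (F z * szego w z)"
  let ?G = "\<lambda>z. F (affine_symbol a z)"
  let ?I = "hardy2_inner (\<lambda>z. ?G z * szego s z) (\<lambda>z. F z * szego s z)"
  have G: "?G holomorphic_on ball 0 1"
  proof -
    have "affine_symbol a holomorphic_on ball 0 1"
      unfolding affine_symbol_def[abs_def] by (intro holomorphic_intros)
    then have "F \<circ> affine_symbol a holomorphic_on ball 0 1"
      using hardy2_holomorphic[OF algebraic_innerD(1)[OF F]] affine_symbol_in_ball[OF a]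
      by (intro holomorphic_on_compose_gen[where t = "ball 0 1"]) auto
    then show ?thesis
      by (simp add: o_def)
  qed
  \<comment> \<open>The composite of \<open>F\<close> with the affine map need not be inner, so
    multiplication by it is only a contraction; this is why an inequality results.\<close>
  have G1: "cmod (?G z) \<le> 1" if "z \<in> ball 0 1" for z
    by (rule algebraic_inner_bounded[OF F affine_symbol_in_ball[OF a that]])
  note GK = hardy2_bounded_mult[OF G G1 K]
  have orth: "hardy2_inner (?k \<circ> affine_symbol a) (\<lambda>z. F z * szego s z) = 0"
    using inv[OF model_space_kernel[OF F w]] K unfolding model_space_iff by blast
  have eq1: "hardy2_inner (?k \<circ> affine_symbol a) (\<lambda>z. F z * szego s z) =
      hardy2_inner (\<lambda>z. D * szego s z + (- cnj (F w) * D) * (?G z * szego s z)) (\<lambda>z. F z * szego s z)"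
    by (rule hardy2_inner_cong)
       (simp_all add: szego_affine_symbol[OF a w] D_def s_def mult_ac)
  have eq2: "hardy2_inner (\<lambda>z. D * szego s z + (- cnj (F w) * D) * (?G z * szego s z)) (\<lambda>z. F z * szego s z) =
      D * hardy2_inner (szego s) (\<lambda>z. F z * szego s z) + (- cnj (F w) * D) * ?I"
    by (simp only: hardy2_inner_add_left[OF hardy2_cmult[OF K] hardy2_cmult[OF GK] FK]
        hardy2_inner_cmult_left[OF K FK] hardy2_inner_cmult_left[OF GK FK])
  have eq3: "hardy2_inner (szego s) (\<lambda>z. F z * szego s z) = cnj (F s * szego s s)"
    using hardy2_inner_commute[OF K FK] hardy2_inner_szego[OF FK s] by simp
  have cancel: "x = y * i" if "D * x + (- y * D) * i = 0" for x y i
    using that D by (simp add: algebra_simps)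
  have "cnj (F s * szego s s) = cnj (F w) * ?I"
    using orth unfolding eq1 eq2 eq3 by (rule cancel)
  then have "cmod (cnj (F s * szego s s)) = cmod (F w) * cmod ?I"
    by (simp only: norm_mult complex_mod_cnj)
  then have "cmod (F s) * (hardy2_norm (szego s))\<^sup>2 = cmod (F w) * cmod ?I"
    unfolding szego_self[OF s] complex_mod_cnj norm_mult norm_of_real by simp
  also have "cmod ?I \<le> (hardy2_norm (szego s))\<^sup>2"
  proof -
    have "cmod ?I \<le> hardy2_norm (\<lambda>z. ?G z * szego s z) * hardy2_norm (\<lambda>z. F z * szego s z)"
      by (rule hardy2_Cauchy_Schwarz(2)[OF GK FK])
    also have "\<dots> \<le> hardy2_norm (szego s) * hardy2_norm (szego s)"
      using hardy2_norm_bounded_mult[OF G G1 K] hardy2_norm_inner_mult_le[OF F K]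
      by (intro mult_mono hardy2_norm_nonneg K FK)
    finally show ?thesis
      by (simp add: power2_eq_square)
  qed
  finally show ?thesis
    using hardy2_norm_szego_pos[OF s] by (simp add: s_def mult_left_mono)
qed

text \<open>The affine symbols are dilations centred at their common fixed point \<open>1\<close>,
  so their ratios multiply under composition.\<close>

lemma invariant_under_affine_power:
  assumes "invariant_under (comp_op (affine_symbol a)) M" "f \<in> M"
  shows "f \<circ> affine_symbol (a ^ k) \<in> M"
proof (induction k)
  case 0
  have "affine_symbol (a ^ 0) = id"
    by (auto simp: affine_symbol_def)
  with assms show ?case
    by simp
next
  case (Suc k)
  have "affine_symbol (a ^ Suc k) = affine_symbol (a ^ k) \<circ> affine_symbol a"
    by (auto simp: affine_symbol_def algebra_simps)
  then have "f \<circ> affine_symbol (a ^ Suc k) = comp_op (affine_symbol a) (f \<circ> affine_symbol (a ^ k))"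
    by (simp add: comp_op_def comp_assoc)
  moreover have "comp_op (affine_symbol a) (f \<circ> affine_symbol (a ^ k)) \<in> M"
    using Suc assms(1) unfolding invariant_under_def by blast
  ultimately show ?case
    by (simp only:)
qed

text \<open>\<open>F\<close> has norm one, so some Taylor coefficient is nonzero, and
  \<open>n\<close> is the first such index. Multiplication by \<open>z ^ n\<close> is isometric, so
  \<open>G\<close> inherits the inner condition from \<open>F\<close>.\<close>

lemma algebraic_inner_factor:
  assumes F: "algebraic_inner F"
  obtains n G where "algebraic_inner G" "G 0 \<noteq> 0" "\<And>z. z \<in> ball 0 1 \<Longrightarrow> F z = z ^ n * G z"
proof -
  note H = algebraic_innerD(1)[OF F]
  let ?c = "taylor_coeff F"
  have "\<exists>n. ?c n \<noteq> 0"
  proof (rule ccontr)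
    assume "\<not> (\<exists>n. ?c n \<noteq> 0)"
    then have "hardy2_inner F F = 0"
      by (simp add: hardy2_inner_def)
    with algebraic_inner_self[OF F] show False
      by simp
  qed
  define n where "n = (LEAST n. ?c n \<noteq> 0)"
  have n_least: "?c k = 0" if "k < n" for k
    using not_less_Least[OF that[unfolded n_def]] by simp
  have n: "?c n \<noteq> 0"
    unfolding n_def using \<open>\<exists>n. ?c n \<noteq> 0\<close> by (rule LeastI_ex)
  define G where "G = (\<lambda>z. \<Sum>k. ?c (k + n) * z ^ k)"
  have sums: "(\<lambda>k. ?c (k + n) * z ^ k) sums G z" if "z \<in> ball 0 1" for z
    unfolding G_def
    using sums_summable[OF taylor_coeff_sums[OF hardy2_holomorphic[OF H] that]]
    by (intro summable_sums) (simp add: summable_powser_ignore_initial_segment)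
  have G: "G holomorphic_on ball 0 1" "taylor_coeff G = (\<lambda>k. ?c (k + n))"
    by (rule power_series_unit_disk[OF sums], assumption)+
  have GH: "G \<in> hardy2"
    using hardy2_summable[OF H] by (simp add: hardy2_def G summable_iff_shift[of "\<lambda>k. (cmod (?c k))\<^sup>2"])
  have FG: "F z = z ^ n * G z" if "z \<in> ball 0 1" for z
  proof -
    have "taylor_coeff (\<lambda>z. z ^ n * G z) = ?c"
      by (auto simp: taylor_coeff_shift[OF G(1)] G(2) n_least)
    then have "(\<lambda>k. ?c k * z ^ k) sums (z ^ n * G z)"
      using taylor_coeff_sums[OF hardy2_holomorphic[OF hardy2_shift[OF GH]] that, of n] by simp
    then show ?thesis
      using taylor_coeff_sums[OF hardy2_holomorphic[OF H] that] sums_unique2 by blast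
  qed
  have "hardy2_inner G (\<lambda>z. z ^ m * G z) = (if m = 0 then 1 else 0)" for m
  proof -
    have "hardy2_inner G (\<lambda>z. z ^ m * G z) =
        hardy2_inner (\<lambda>z. z ^ n * G z) (\<lambda>z. z ^ n * (z ^ m * G z))"
      by (rule hardy2_inner_shift[symmetric]) (intro GH hardy2_shift)+
    also have "\<dots> = hardy2_inner F (\<lambda>z. z ^ m * F z)"
      by (rule hardy2_inner_cong) (simp_all add: FG)
    finally show ?thesis
      using F by (simp add: algebraic_inner_def)
  qed
  with GH have "algebraic_inner G"
    by (simp add: algebraic_inner_def)
  moreover have "G 0 \<noteq> 0"
    using sums[of 0] n by (simp add: powser_sums_zero_iff)
  ultimately show ?thesis
    using FG by (rule that)
qed

text \<open>The multiplier bound for \<open>f z / C\<close>, applied to the constant function one,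
  which has norm one.\<close>

lemma hardy2_bounded:
  assumes f: "f holomorphic_on ball 0 1" "\<And>z. z \<in> ball 0 1 \<Longrightarrow> cmod (f z) \<le> C" and C: "0 < C"
  shows "f \<in> hardy2" and "hardy2_norm f \<le> C"
proof -
  have one: "(\<lambda>z. 1) \<in> hardy2"
    using hardy2_power[of 0] by simp
  have tc: "taylor_coeff (\<lambda>z. 1) = (\<lambda>n. if n = 0 then 1 else 0)"
    using taylor_coeff_power[of 0] by simp
  have norm_one: "hardy2_norm (\<lambda>z. 1) = 1"
    unfolding hardy2_norm_def tc by (subst suminf_finite[of "{0}"]) auto
  have g: "(\<lambda>z. f z / of_real C) holomorphic_on ball 0 1"
    using C by (intro holomorphic_intros f) auto
  have g1: "cmod (f z / of_real C) \<le> 1" if "z \<in> ball 0 1" for z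
    using f(2)[OF that] C by (simp add: norm_divide)
  have H: "(\<lambda>z. f z / of_real C) \<in> hardy2" and N: "hardy2_norm (\<lambda>z. f z / of_real C) \<le> 1"
    using hardy2_bounded_mult[OF g g1 one] hardy2_norm_bounded_mult[OF g g1 one] norm_one by auto
  have "f = (\<lambda>z. of_real C * (f z / of_real C))"
    using C by auto
  with hardy2_cmult[OF H, of "of_real C"] hardy2_norm_cmult[OF H, of "of_real C"]
  have "f \<in> hardy2" "hardy2_norm f = C * hardy2_norm (\<lambda>z. f z / of_real C)"
    using C by auto
  with N C show "f \<in> hardy2" "hardy2_norm f \<le> C"
    by (auto simp: mult_left_le)
qed

lemma algebraic_inner_norm_power:
  assumes F: "algebraic_inner F" and h: "h \<in> hardy2"
  shows "(\<lambda>z. F z ^ m * h z) \<in> hardy2" and "hardy2_norm (\<lambda>z. F z ^ m * h z) = hardy2_norm h"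
proof -
  have "(\<lambda>z. F z ^ m * h z) \<in> hardy2 \<and> hardy2_norm (\<lambda>z. F z ^ m * h z) = hardy2_norm h"
  proof (induction m)
    case 0
    with h show ?case
      by simp
  next
    case (Suc m)
    then show ?case
      using hardy2_inner_mult[OF F, of "\<lambda>z. F z ^ m * h z"] algebraic_inner_norm[OF F, of "\<lambda>z. F z ^ m * h z"]
      by (simp add: mult.assoc)
  qed
  then show "(\<lambda>z. F z ^ m * h z) \<in> hardy2" "hardy2_norm (\<lambda>z. F z ^ m * h z) = hardy2_norm h"
    by auto
qed

text \<open>A substitute for the Smirnov maximum principle: the powers of \<open>u\<close> have \<open>H\<^sup>2\<close> norm at most one
  because multiplication by \<open>G\<close> is isometric, so the values of \<open>u\<close> cannot exceed one in modulus.\<close>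

lemma bounded_quotient_by_inner:
  assumes G: "algebraic_inner G" and u: "u holomorphic_on ball 0 1"
    and bounded: "0 < C" "\<And>z. z \<in> ball 0 1 \<Longrightarrow> cmod (u z) \<le> C"
    and Gu: "\<And>z. z \<in> ball 0 1 \<Longrightarrow> cmod (G z * u z) \<le> 1"
    and w: "w \<in> ball 0 1"
  shows "cmod (u w) \<le> 1"
proof (rule ccontr)
  assume "\<not> cmod (u w) \<le> 1"
  then obtain m where m: "hardy2_norm (szego w) < cmod (u w) ^ m"
    using real_arch_pow[of "cmod (u w)"] by auto
  \<comment> \<open>Here the bound \<open>C\<close> enters: it places the powers of \<open>u\<close>
    in the Hardy space. Their norms are then estimated through \<open>G z * u z\<close>,
    independently of the size of \<open>C\<close>.\<close>
  have um: "(\<lambda>z. u z ^ m) \<in> hardy2"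
  proof (rule hardy2_bounded(1))
    show "(\<lambda>z. u z ^ m) holomorphic_on ball 0 1"
      by (intro holomorphic_intros u)
    show "cmod (u z ^ m) \<le> C ^ m" if "z \<in> ball 0 1" for z
      unfolding norm_power by (intro power_mono bounded that norm_ge_zero)
  qed (use bounded in auto)
  have "hardy2_norm (\<lambda>z. u z ^ m) = hardy2_norm (\<lambda>z. (G z * u z) ^ m)"
    using algebraic_inner_norm_power(2)[OF G um, of m] by (simp add: power_mult_distrib)
  also have "\<dots> \<le> 1"
  proof (rule hardy2_bounded(2))
    show "(\<lambda>z. (G z * u z) ^ m) holomorphic_on ball 0 1"
      by (intro holomorphic_intros u hardy2_holomorphic[OF algebraic_innerD(1)[OF G]])
    show "cmod ((G z * u z) ^ m) \<le> 1" if "z \<in> ball 0 1" for z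
      unfolding norm_power by (intro power_le_one Gu that norm_ge_zero)
  qed simp
  finally have "hardy2_norm (\<lambda>z. u z ^ m) * hardy2_norm (szego w) \<le> 1 * hardy2_norm (szego w)"
    by (intro mult_right_mono hardy2_norm_nonneg hardy2_szego w)
  with hardy2_pointwise_bound[OF um w] m show False
    by (simp add: norm_power)
qed

lemma adjoint_symbol_tendsto_0:
  assumes "0 < a" "a < 1" "w \<in> ball 0 1"
  shows "(\<lambda>k. adjoint_symbol (a ^ k) w) \<longlonglongrightarrow> 0"
proof -
  have "w \<noteq> 1"
    using assms by auto
  have "(\<lambda>k. a ^ k) \<longlonglongrightarrow> 0"
    using assms by (intro LIMSEQ_power_zero) simp
  then have "(\<lambda>k. complex_of_real (a ^ k)) \<longlonglongrightarrow> of_real 0"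
    by (rule tendsto_of_real)
  then have "(\<lambda>k. complex_of_real (a ^ k) * w / (1 - (1 - complex_of_real (a ^ k)) * w)) \<longlonglongrightarrow>
      of_real 0 * w / (1 - (1 - of_real 0) * w)"
    using \<open>w \<noteq> 1\<close> by (intro tendsto_intros) (use assms in auto)
  then show ?thesis
    by (simp add: adjoint_symbol_def)
qed

lemma invariant_model_space_monomial:
  assumes F: "algebraic_inner F" and a: "0 < a" "a < 1"
    and inv: "invariant_under (comp_op (affine_symbol a)) (model_space F)"
  obtains n c where "cmod c = 1" "\<And>z. z \<in> ball 0 1 \<Longrightarrow> F z = c * z ^ n"
proof -
  obtain G n where G: "algebraic_inner G" and G0: "G 0 \<noteq> 0"
    and FG: "\<And>z. z \<in> ball 0 1 \<Longrightarrow> F z = z ^ n * G z"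
    using algebraic_inner_factor[OF F] by metis
  have ak: "0 < a ^ k" "a ^ k \<le> 1" for k
    using a by (auto intro: power_le_one)
  note sb = adjoint_symbol_in_ball[OF ak]
  have F_le: "cmod (F (adjoint_symbol (a ^ k) w)) \<le> cmod (F w)" if "w \<in> ball 0 1" for k w
    using invariant_model_space_norm_le[OF F ak that invariant_under_affine_power[OF inv]] .
  have hol: "G holomorphic_on ball 0 1"
    by (rule hardy2_holomorphic[OF algebraic_innerD(1)[OF G]])
  then have "isCont G 0"
    using continuous_on_interior[OF holomorphic_on_imp_continuous_on, of G "ball 0 1" 0] by simp
  then have Glim: "(\<lambda>k. G (adjoint_symbol (a ^ k) w)) \<longlonglongrightarrow> G 0" if "w \<in> ball 0 1" for w
    by (rule isCont_tendsto_compose) (rule adjoint_symbol_tendsto_0[OF a that])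
  \<comment> \<open>By the modulus inequality a zero at \<open>w\<close> is passed on to all points
    \<open>adjoint_symbol (a ^ k) w\<close>. These are nonzero, so the power of \<open>z\<close> can
    be cancelled there, and they tend to \<open>0\<close>, where \<open>G\<close> does not
    vanish.\<close>
  have Gnz: "G w \<noteq> 0" if w: "w \<in> ball 0 1" for w
  proof
    assume Gw: "G w = 0"
    with G0 have "w \<noteq> 0"
      by auto
    have "G (adjoint_symbol (a ^ k) w) = 0" for k
    proof -
      have "F (adjoint_symbol (a ^ k) w) = 0"
        using F_le[OF w, of k] by (simp add: FG[OF w] Gw)
      moreover have "adjoint_symbol (a ^ k) w \<noteq> 0"
        using a \<open>w \<noteq> 0\<close> adjoint_symbol_denominator[OF ak w, of k] by (simp add: adjoint_symbol_def)
      ultimately show ?thesis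
        by (simp add: FG[OF sb[OF w]])
    qed
    then have "G 0 = 0"
      using Glim[OF w] by (simp add: LIMSEQ_const_iff)
    with G0 show False
      by simp
  qed
  have G_le: "cmod (G (adjoint_symbol (a ^ k) w)) \<le> cmod (G w)" if w: "w \<in> ball 0 1" for k w
  proof -
    define b where "b = a ^ k"
    have b: "0 < b" "b \<le> 1"
      using ak by (auto simp: b_def)
    define u where "u = (\<lambda>z. G (adjoint_symbol b z) / G z)"
    have "cmod (u w) \<le> 1"
    \<comment> \<open>The constant bounds \<open>|z / adjoint_symbol b z| ^ n\<close>: the quotient
      equals \<open>(1 - (1 - b) * z) / b\<close>, and its numerator has modulus at most
      \<open>2\<close>.\<close>
    proof (rule bounded_quotient_by_inner[OF G, where u = u and w = w and C = "(2 / b) ^ n"])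
      have "(\<lambda>z. G (adjoint_symbol b z)) holomorphic_on ball 0 1"
      proof -
        have "adjoint_symbol b holomorphic_on ball 0 1"
          unfolding adjoint_symbol_def[abs_def]
          by (intro holomorphic_intros adjoint_symbol_denominator[OF b])
        then have "G \<circ> adjoint_symbol b holomorphic_on ball 0 1"
          using hol adjoint_symbol_in_ball[OF b]
          by (intro holomorphic_on_compose_gen[where t = "ball 0 1"]) auto
        then show ?thesis
          by (simp add: o_def)
      qed
      then show "u holomorphic_on ball 0 1"
        unfolding u_def by (intro holomorphic_intros hol Gnz)
      show "0 < (2 / b) ^ n"
        using b by simp
      show "cmod (G z * u z) \<le> 1" if z: "z \<in> ball 0 1" for z
        using algebraic_inner_bounded[OF G adjoint_symbol_in_ball[OF b z]] Gnz[OF z] by (simp add: u_def)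
      show "cmod (u z) \<le> (2 / b) ^ n" if z: "z \<in> ball 0 1" for z
      proof (cases "z = 0")
        \<comment> \<open>The power of \<open>z\<close> cannot be cancelled at the origin, but
          \<open>adjoint_symbol b\<close> fixes it, so \<open>u 0 = 1\<close>.\<close>
        case True
        then show ?thesis
          using b G0 by (simp add: u_def adjoint_symbol_def)
      next
        case False
        let ?D = "1 - (1 - complex_of_real b) * z"
        have D: "0 < cmod ?D"
          using adjoint_symbol_denominator[OF b z] by simp
        have "cmod ?D \<le> 2"
        proof -
          have "cmod ((1 - of_real b) * z) = (1 - b) * cmod z"
            using b norm_of_real[of "1 - b", where 'a = complex] by (simp add: norm_mult)
          also have "\<dots> \<le> 1 * 1"
            using b z by (intro mult_mono) auto
          finally show ?thesis
            using norm_triangle_ineq4[of 1 "(1 - of_real b) * z"] by simp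
        qed
        have "cmod (adjoint_symbol b z) = cmod z * (b / cmod ?D)"
          using b by (simp add: adjoint_symbol_def norm_mult norm_divide)
        then have "cmod z ^ n * ((b / cmod ?D) ^ n * cmod (G (adjoint_symbol b z))) \<le> cmod z ^ n * cmod (G z)"
          using F_le[OF z, of k]
          by (simp only: FG[OF z] FG[OF adjoint_symbol_in_ball[OF b z]] b_def[symmetric] norm_mult
              norm_power power_mult_distrib mult.assoc)
        then have "(b / cmod ?D) ^ n * cmod (G (adjoint_symbol b z)) \<le> cmod (G z)"
          by (rule mult_left_le_imp_le) (use False in simp)
        moreover have "cmod (G (adjoint_symbol b z)) = cmod (u z) * cmod (G z)"
          using Gnz[OF z] by (simp add: u_def norm_divide)
        ultimately have "((b / cmod ?D) ^ n * cmod (u z)) * cmod (G z) \<le> 1 * cmod (G z)"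
          by (simp only: mult.assoc mult_1_left)
        then have "(b / cmod ?D) ^ n * cmod (u z) \<le> 1"
          by (rule mult_right_le_imp_le) (use Gnz[OF z] in simp)
        then have "cmod (u z) \<le> (cmod ?D / b) ^ n"
          using b D by (simp add: field_simps power_divide)
        also have "\<dots> \<le> (2 / b) ^ n"
          using b \<open>cmod ?D \<le> 2\<close> by (intro power_mono divide_right_mono) auto
        finally show ?thesis .
      qed
    qed (use w in auto)
    then show ?thesis
      using Gnz[OF w] by (simp add: u_def b_def norm_divide divide_simps)
  qed
  have G0_le: "cmod (G 0) \<le> cmod (G w)" if "w \<in> ball 0 1" for w
    by (rule LIMSEQ_le_const2[OF tendsto_norm[OF Glim[OF that]]]) (use G_le[OF that] in blast)
  have "(\<lambda>z. inverse (G z)) constant_on ball 0 1"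
  proof (rule maximum_modulus_principle[where U = "ball 0 1" and \<xi> = 0])
    show "(\<lambda>z. inverse (G z)) holomorphic_on ball 0 1"
      by (intro holomorphic_intros hol Gnz)
    show "cmod (inverse (G z)) \<le> cmod (inverse (G 0))" if "z \<in> ball 0 1" for z
      unfolding norm_inverse using G0 by (intro le_imp_inverse_le G0_le that) simp
  qed auto
  then obtain d where d: "\<And>z. z \<in> ball 0 1 \<Longrightarrow> inverse (G z) = d"
    by (auto simp: constant_on_def)
  then have Gc: "G z = inverse d" if "z \<in> ball 0 1" for z
    using that by (metis inverse_inverse_eq)
  have one: "(\<lambda>z. z ^ 0) \<in> hardy2"
    by (rule hardy2_power)
  \<comment> \<open>The constant value of \<open>G\<close> is unimodular because \<open>G\<close>
    has norm one.\<close>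
  have "1 = hardy2_inner G G"
    by (simp add: algebraic_inner_self[OF G])
  also have "\<dots> = hardy2_inner (\<lambda>z. inverse d * z ^ 0) (\<lambda>z. inverse d * z ^ 0)"
    by (rule hardy2_inner_cong) (simp_all add: Gc)
  also have "\<dots> = inverse d * (cnj (inverse d) * hardy2_inner (\<lambda>z. z ^ 0) (\<lambda>z. z ^ 0))"
    by (simp only: hardy2_inner_cmult_left[OF one hardy2_cmult[OF one]] hardy2_inner_cmult_right[OF one one])
  also have "hardy2_inner (\<lambda>z. z ^ 0) (\<lambda>z. z ^ 0) = 1"
    unfolding hardy2_inner_power[OF one] taylor_coeff_power by simp
  finally have "complex_of_real ((cmod (inverse d))\<^sup>2) = of_real 1"
    unfolding complex_norm_square by simp
  then have "cmod (inverse d) = 1"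
    unfolding of_real_eq_iff using norm_ge_zero[of "inverse d"] by (simp only: power2_eq_1_iff) linarith
  then show ?thesis
    using that[of "inverse d" n] FG Gc by (simp add: mult.commute)
qed

section \<open>The converse: model spaces of monomials\<close>

lemma model_space_cmult_power:
  assumes c: "c \<noteq> 0" and F: "\<And>z. z \<in> ball 0 1 \<Longrightarrow> F z = c * z ^ n"
  shows "model_space F = model_space (\<lambda>z. z ^ n)"
proof -
  have "hardy2_inner f (\<lambda>z. F z * h z) = 0 \<longleftrightarrow> hardy2_inner f (\<lambda>z. z ^ n * h z) = 0"
    if f: "f \<in> hardy2" and h: "h \<in> hardy2" for f h
  proof -
    have "hardy2_inner f (\<lambda>z. F z * h z) = hardy2_inner f (\<lambda>z. c * (z ^ n * h z))"
      by (rule hardy2_inner_cong) (simp_all add: F mult.assoc)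
    also have "\<dots> = cnj c * hardy2_inner f (\<lambda>z. z ^ n * h z)"
      by (rule hardy2_inner_cmult_right[OF hardy2_shift[OF h] f])
    finally show ?thesis
      using c by simp
  qed
  then show ?thesis
    by (auto simp: model_space_iff)
qed

text \<open>Pairing with \<open>z ^ k\<close> reads off the \<open>k\<close>-th coefficient. On the
  disk the members are therefore the polynomials of degree below \<open>n\<close>.\<close>

lemma model_space_power:
  "f \<in> model_space (\<lambda>z. z ^ n) \<longleftrightarrow> f \<in> hardy2 \<and> (\<forall>k\<ge>n. taylor_coeff f k = 0)"
proof safe
  assume f: "f \<in> model_space (\<lambda>z. z ^ n)"
  then show H: "f \<in> hardy2"
    by (simp add: model_space_iff)
  fix k assume "n \<le> k"
  then have "(\<lambda>z. z ^ n * z ^ (k - n)) = (\<lambda>z :: complex. z ^ k)"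
    by (simp add: power_add[symmetric])
  moreover have "hardy2_inner f (\<lambda>z. z ^ n * z ^ (k - n)) = 0"
    using f[unfolded model_space_iff, THEN conjunct2] by (rule bspec) (rule hardy2_power)
  ultimately show "taylor_coeff f k = 0"
    by (simp add: hardy2_inner_power[OF H])
next
  assume "f \<in> hardy2" and "\<forall>k\<ge>n. taylor_coeff f k = 0"
  moreover have "hardy2_inner f (\<lambda>z. z ^ n * h z) = 0" if "h \<in> hardy2" for h
  proof -
    have "taylor_coeff f k * cnj (taylor_coeff (\<lambda>z. z ^ n * h z) k) = 0" for k
      using calculation
      by (cases "k < n") (simp_all add: taylor_coeff_shift[OF hardy2_holomorphic[OF that]])
    then show ?thesis
      unfolding hardy2_inner_def by (simp only: suminf_zero)
  qed
  ultimately show "f \<in> model_space (\<lambda>z. z ^ n)"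
    by (simp add: model_space_iff)
qed

text \<open>Substituting an affine map into a polynomial does not raise its degree.\<close>

lemma invariant_model_space_power:
  assumes a: "0 < a" "a \<le> 1"
  shows "invariant_under (comp_op (affine_symbol a)) (model_space (\<lambda>z. z ^ n))"
  unfolding invariant_under_def comp_op_def
proof safe
  fix f assume f: "f \<in> model_space (\<lambda>z. z ^ n)"
  then have H: "f \<in> hardy2" and c: "\<And>k. n \<le> k \<Longrightarrow> taylor_coeff f k = 0"
    by (auto simp: model_space_power)
  define p where "p = (\<Sum>k<n. monom (taylor_coeff f k) k)"
  define q where "q = pcompose p [:1 - of_real a, of_real a:]"
  have fp: "f z = poly p z" if "z \<in> ball 0 1" for z
  proof -
    have "(\<lambda>k. taylor_coeff f k * z ^ k) sums (\<Sum>k<n. taylor_coeff f k * z ^ k)"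
      by (rule sums_finite) (auto simp: c)
    with taylor_coeff_sums[OF hardy2_holomorphic[OF H] that] show ?thesis
      using sums_unique2 by (auto simp: p_def poly_sum poly_monom)
  qed
  have fq: "(f \<circ> affine_symbol a) z = poly q z" if "z \<in> ball 0 1" for z
    using fp[OF affine_symbol_in_ball[OF a that]]
    by (simp add: q_def poly_pcompose affine_symbol_def algebra_simps)
  have "coeff q k = 0" if "n \<le> k" for k
  \<comment> \<open>For \<open>n = 0\<close> a bound of the degree by the truncated
    \<open>n - 1\<close> would still allow constants, while the space contains only zero; here
    \<open>p\<close> is an empty sum.\<close>
  proof (cases "n = 0")
    case True
    then show ?thesis
      by (simp add: q_def p_def)
  next
    case False
    have "degree p \<le> n - 1"
      unfolding p_def using False by (intro degree_sum_le) (auto intro!: order_trans[OF degree_monom_le])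
    moreover have "degree q \<le> degree p"
      unfolding q_def using degree_pcompose_le[of p "[:1 - of_real a, of_real a:]"] a by simp
    ultimately show ?thesis
      using False that by (intro coeff_eq_0) linarith
  qed
  moreover have "taylor_coeff (f \<circ> affine_symbol a) = coeff q"
    unfolding taylor_coeff_poly[symmetric] by (rule taylor_coeff_cong[OF fq])
  moreover have "poly q \<in> hardy2"
  proof -
    have "summable (\<lambda>k. (cmod (taylor_coeff (poly q) k))\<^sup>2)"
      by (rule summable_finite[of "{..degree q}"]) (auto simp: taylor_coeff_poly coeff_eq_0)
    then show ?thesis
      by (auto simp: hardy2_def intro!: holomorphic_intros)
  qed
  ultimately show "f \<circ> affine_symbol a \<in> model_space (\<lambda>z. z ^ n)"
    using hardy2_cong[of "f \<circ> affine_symbol a" "poly q", OF fq] by (simp only: model_space_power) simp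
qed

theorem theorem8:
  fixes a :: real and \<Theta> :: "complex \<Rightarrow> complex"
  assumes "0 < a" and "a < 1"
    and "inner_function \<Theta>"
  shows "(invariant_under (comp_op (affine_symbol a)) (model_space \<Theta>)
            \<longleftrightarrow> (\<exists>n::nat. model_space \<Theta> = model_space (\<lambda>z. z ^ n))) \<and>
         ((\<exists>n::nat. model_space \<Theta> = model_space (\<lambda>z. z ^ n))
            \<longleftrightarrow> (\<exists>(n::nat) (c::complex). cmod c = 1 \<and> (\<forall>z\<in>ball 0 1. \<Theta> z = c * z ^ n)))"
    (is "(?inv \<longleftrightarrow> ?same) \<and> (?same \<longleftrightarrow> ?form)")
proof -
  \<comment> \<open>The implications run in a cycle from \<open>?inv\<close> to \<open>?form\<close>
    to \<open>?same\<close> and back. In particular, that equality of the model spaces determines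
    \<open>\<Theta>\<close> up to a unimodular factor is obtained by way of invariance.\<close>
  have "?form" if ?inv
    using invariant_model_space_monomial[OF inner_function_algebraic[OF assms(3)] assms(1,2) that] by metis
  moreover have ?same if ?form
  proof -
    from that obtain n c where "cmod c = 1" "\<forall>z\<in>ball 0 1. \<Theta> z = c * z ^ n"
      by auto
    then have "model_space \<Theta> = model_space (\<lambda>z. z ^ n)"
      by (intro model_space_cmult_power[of c]) auto
    then show ?thesis ..
  qed
  moreover have ?inv if ?same
    using that invariant_model_space_power[of a] assms(1,2) by auto
  ultimately show ?thesis
    by blast
qed

end
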